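(* Let $\mathcal{K}=(K;+,\cdot,\mathrm{D})$ be a differential field with field of constants $C$. Let $n\ge1$, $c_0,\dots,c_{n-1}\in C$ with $c_0\ne0$, and assume that $p(\lambda)=\lambda^n+c_{n-1}\lambda^{n-1}+\dots+c_1\lambda+c_0$ splits over $C$, with roots $\lambda_1,\dots,\lambda_n\in C$ listed with multiplicity. Let $(x_i,y_i)\in K^2$, $i=1,\dots,m$, satisfy $x_i\notin C$ and $\Delta(x_i,y_i)=0$, and suppose that for every $i$ the elements $y_i,\partial_{x_i}y_i,\dots,\partial_{x_i}^{n-1}y_i$ are linearly independent over $C$. Then $$\operatorname{td}_C C(\bar x,\bar y,\partial_{\bar x}\bar y,\dots,\partial_{\bar x}^{n-1}\bar y)\ \ge\ \operatorname{ldim}_{\mathbb{Q}}(\lambda_1\bar x,\dots,\lambda_n\bar x/C)+1,$$ where $\partial_{\bar x}^j\bar y=(\partial_{x_1}^jy_1,\dots,\partial_{x_m}^jy_m)$.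
   Context: For $x\in K\setminus C$, $\partial_x=(\mathrm{D}x)^{-1}\mathrm{D}$ is a derivation of $K$, and $$\Delta(x,y):=(\mathrm{D}x)^{2n-1}\left[\partial_x^ny+c_{n-1}\partial_x^{n-1}y+\dots+c_1\partial_xy+c_0y\right].$$ $\operatorname{td}_C$ denotes transcendence degree over $C$. $\operatorname{ldim}_{\mathbb{Q}}(\lambda_1\bar x,\dots,\lambda_n\bar x/C)$ is the dimension of the $\mathbb{Q}$-linear span of the images of the $mn$ elements $\lambda_jx_i$ ($1\le j\le n$, $1\le i\le m$) in the quotient $\mathbb{Q}$-vector space $K/C$. *)

theory Defs
  imports Complex_Main "HOL-Library.Extended_Nat" "HOL-Library.Poly_Mapping"
    "HOL-Computational_Algebra.Polynomial"
begin

class differential_field = field_char_0 +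
  fixes der :: "'a \<Rightarrow> 'a"
  assumes der_add: "der (x + y) = der x + der y"
    and der_mult: "der (x * y) = der x * y + x * der y"
begin

definition constants :: "'a set" where
  "constants = {x. der x = 0}"

definition der_wrt :: "'a \<Rightarrow> 'a \<Rightarrow> 'a" where
  "der_wrt x y = inverse (der x) * der y"

text \<open>The arguments \<open>n\<close> and \<open>c\<close> are the order of the equation and its coefficients
  \<open>c 0, \<dots>, c (n - 1)\<close>; the exponent \<open>2 * n - 1\<close> is only meant for \<open>n \<ge> 1\<close>.\<close>

definition Delta :: "nat \<Rightarrow> (nat \<Rightarrow> 'a) \<Rightarrow> 'a \<Rightarrow> 'a \<Rightarrow> 'a" where
  "Delta n c x y =
     der x ^ (2 * n - 1) * ((der_wrt x ^^ n) y + (\<Sum>k<n. c k * (der_wrt x ^^ k) y))"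

lemma der_zero [simp]: "der 0 = 0"
  using der_add[of 0 0] by simp

lemma der_uminus: "der (- x) = - der x"
  using der_add[of x "- x"] by (simp add: eq_neg_iff_add_eq_0 add.commute)

lemma der_diff: "der (x - y) = der x - der y"
  using der_add[of x "- y"] by (simp add: der_uminus)

lemma der_one [simp]: "der 1 = 0"
  using der_mult[of 1 1] by simp

lemma der_of_nat [simp]: "der (of_nat k) = 0"
  by (induction k) (simp_all add: der_add)

lemma der_of_int [simp]: "der (of_int k) = 0"
  by (cases k rule: int_cases2) (simp_all add: der_uminus)

end

lemma der_of_rat [simp]: "der (of_rat q :: 'a::differential_field) = 0"
proof (cases q)
  case (Fract a b)
  then have "(of_int a :: 'a) = of_rat q * of_int b"
    by (simp add: of_rat_rat)
  then have "der (of_int a :: 'a) = der (of_rat q * of_int b)"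
    by simp
  then show ?thesis
    using Fract by (simp add: der_mult)
qed

lemma der_of_rat_mult: "der (of_rat q * x :: 'a::differential_field) = of_rat q * der x"
  by (simp add: der_mult)


subsection \<open>The rational vector space \<open>K/C\<close>\<close>

quotient_type (overloaded) 'a mod_constants =
  "'a::differential_field" / "\<lambda>x y. x - y \<in> constants"
  morphisms rep_mod_constants to_mod_constants
proof (rule equivpI)
  show "reflp (\<lambda>x y :: 'a. x - y \<in> constants)"
    by (auto simp: reflp_def constants_def)
  show "symp (\<lambda>x y :: 'a. x - y \<in> constants)"
    by (auto simp: symp_def constants_def der_diff)
  show "transp (\<lambda>x y :: 'a. x - y \<in> constants)"
    by (auto simp: transp_def constants_def der_diff)
qed

instantiation mod_constants :: (differential_field) ab_group_add
begin

lift_definition zero_mod_constants :: "'a mod_constants" is 0 .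

lift_definition plus_mod_constants ::
    "'a mod_constants \<Rightarrow> 'a mod_constants \<Rightarrow> 'a mod_constants" is "(+)"
  by (auto simp: constants_def der_diff der_add)

lift_definition uminus_mod_constants :: "'a mod_constants \<Rightarrow> 'a mod_constants" is uminus
  by (auto simp: constants_def der_diff der_uminus)

lift_definition minus_mod_constants ::
    "'a mod_constants \<Rightarrow> 'a mod_constants \<Rightarrow> 'a mod_constants" is "(-)"
  by (auto simp: constants_def der_diff)

instance
  by standard (transfer; simp add: constants_def algebra_simps)+

end

lift_definition scale_mod_constants ::
    "rat \<Rightarrow> 'a::differential_field mod_constants \<Rightarrow> 'a mod_constants"
  is "\<lambda>q x. of_rat q * x"
  by (auto simp: constants_def der_diff der_of_rat_mult)

global_interpretation mod_constants: vector_space scale_mod_constants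
  by unfold_locales
    (transfer; simp add: constants_def of_rat_add of_rat_mult algebra_simps)+

definition ldim_mod_constants :: "'a::differential_field set \<Rightarrow> nat" where
  "ldim_mod_constants S = mod_constants.dim (mod_constants.span (to_mod_constants ` S))"


subsection \<open>Linear independence, generated subfields and transcendence degree\<close>

text \<open>Independence is that of the family \<open>v 0, \<dots>, v (n - 1)\<close>, so repetitions count.\<close>

definition lin_indep_over :: "'a::field set \<Rightarrow> nat \<Rightarrow> (nat \<Rightarrow> 'a) \<Rightarrow> bool" where
  "lin_indep_over F n v \<longleftrightarrow>
     (\<forall>a. (\<forall>j<n. a j \<in> F) \<longrightarrow> (\<Sum>j<n. a j * v j) = 0 \<longrightarrow> (\<forall>j<n. a j = 0))"

definition is_subfield :: "'a::field set \<Rightarrow> bool" where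
  "is_subfield F \<longleftrightarrow> 0 \<in> F \<and> 1 \<in> F \<and>
     (\<forall>x\<in>F. \<forall>y\<in>F. x + y \<in> F \<and> x * y \<in> F) \<and> (\<forall>x\<in>F. - x \<in> F \<and> inverse x \<in> F)"

definition adjoin :: "'a::field set \<Rightarrow> 'a set \<Rightarrow> 'a set" where
  "adjoin F S = \<Inter>{L. is_subfield L \<and> F \<subseteq> L \<and> S \<subseteq> L}"

text \<open>A polynomial in variables named by field elements is a finitely supported map from
  monomials (finitely supported exponent functions) to coefficients; it is evaluated by
  substituting for each variable the element that names it.\<close>

definition eval_at_names :: "(('a \<Rightarrow>\<^sub>0 nat) \<Rightarrow>\<^sub>0 'a) \<Rightarrow> 'a::field" where
  "eval_at_names P = (\<Sum>\<mu>\<in>Poly_Mapping.keys P.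
     Poly_Mapping.lookup P \<mu> * (\<Prod>s\<in>Poly_Mapping.keys \<mu>. s ^ Poly_Mapping.lookup \<mu> s))"

definition alg_indep_over :: "'a::field set \<Rightarrow> 'a set \<Rightarrow> bool" where
  "alg_indep_over F S \<longleftrightarrow>
     (\<forall>P. (\<forall>\<mu>. Poly_Mapping.lookup P \<mu> \<in> F) \<longrightarrow>
          (\<forall>\<mu>\<in>Poly_Mapping.keys P. Poly_Mapping.keys \<mu> \<subseteq> S) \<longrightarrow>
          eval_at_names P = 0 \<longrightarrow> P = 0)"

text \<open>Largest size of an algebraically independent subset of \<open>L\<close>, with value \<open>\<infinity>\<close> if the
  finite ones are arbitrarily large.\<close>

definition trdeg :: "'a::field set \<Rightarrow> 'a set \<Rightarrow> enat" where
  "trdeg F L = (SUP S\<in>{S. S \<subseteq> L \<and> finite S \<and> alg_indep_over F S}. enat (card S))"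

end

theory Submission
  imports Defs "Jordan_Normal_Form.Determinant" "HOL-Computational_Algebra.Formal_Laurent_Series"
begin

text \<open>If \<open>p(T) = (T - \<lambda>\<^sub>j) q(T)\<close>, then \<open>v = q(\<partial>\<^sub>x) y\<close> satisfies \<open>\<partial>\<^sub>x v = \<lambda>\<^sub>j v\<close>, and it is nonzero by linear
  independence; so \<open>D v = v D(\<lambda>\<^sub>j x)\<close>, and the statement follows from Ax's theorem for the pairs
  \<open>(\<lambda>\<^sub>j x\<^sub>i, v\<^sub>i\<^sub>j)\<close>.

  Ax's theorem concerns pairs \<open>(z, e\<^sub>z)\<close> with \<open>D e\<^sub>z = e\<^sub>z D z\<close> and the \<open>z\<close> linearly independent over the
  rationals modulo \<open>C\<close>. Instead of differential forms we use the \<open>C\<close>-derivations \<open>\<delta>\<close> of \<open>K\<close>, and the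
  vectors \<open>u(\<delta>) = (\<delta> e\<^sub>z / e\<^sub>z - \<delta> z)\<^sub>z\<close>. As \<open>u(D) = 0\<close>, a transcendence degree of at most the number of
  the \<open>z\<close> forces a linear relation among the components of all \<open>u(\<delta>)\<close>, and as \<open>D u(\<delta>) = u([D, \<delta>])\<close>, a
  shortest relation has constant coefficients \<open>c\<^sub>z\<close>. The rational vectors \<open>q\<close> with \<open>\<Sum> c\<^sub>z q\<^sub>z = 0\<close> are
  annihilated by some nonzero integer vector \<open>k\<close>. Then \<open>X = \<Prod> e\<^sub>z ^ k\<^sub>z\<close> is not constant, hence
  transcendental over \<open>C\<close>. Let \<open>F\<close> be a subfield containing \<open>C\<close> and maximal such that \<open>X\<close> is
  transcendental over \<open>F\<close>; then \<open>K\<close> is algebraic over \<open>F(X)\<close>, and \<open>X d/dX\<close> extends to a derivation \<open>\<theta>\<close> of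
  \<open>K\<close>. The residue at \<open>X = 0\<close> of the trace down to \<open>F(X)\<close> kills every \<open>\<theta> v\<close> and maps every \<open>\<theta> f / f\<close> to an
  integer, the order of the norm of \<open>f\<close>. Applied to the relation for \<open>\<theta>\<close> it gives integers \<open>q\<^sub>z\<close> with
  \<open>\<Sum> c\<^sub>z q\<^sub>z = 0\<close>, so \<open>\<Sum> k\<^sub>z q\<^sub>z = 0\<close>; but the latter sum is the residue of \<open>\<theta> X / X = 1\<close>.\<close>


section \<open>Subfields and adjunction\<close>

lemma
  assumes "is_subfield E"
  shows subfield_0: "0 \<in> E" and subfield_1: "1 \<in> E"
    and subfield_add: "x \<in> E \<Longrightarrow> y \<in> E \<Longrightarrow> x + y \<in> E"
    and subfield_mult: "x \<in> E \<Longrightarrow> y \<in> E \<Longrightarrow> x * y \<in> E"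
    and subfield_uminus: "x \<in> E \<Longrightarrow> - x \<in> E"
    and subfield_inverse: "x \<in> E \<Longrightarrow> inverse x \<in> E"
  using assms by (auto simp: is_subfield_def)

lemma subfield_diff: "is_subfield E \<Longrightarrow> x \<in> E \<Longrightarrow> y \<in> E \<Longrightarrow> x - y \<in> E"
  using subfield_add[of E x "- y"] subfield_uminus[of E y] by simp

lemma subfield_divide: "is_subfield E \<Longrightarrow> x \<in> E \<Longrightarrow> y \<in> E \<Longrightarrow> x / y \<in> E"
  by (simp add: divide_inverse subfield_mult subfield_inverse)

lemma subfield_sum: "is_subfield E \<Longrightarrow> (\<And>i. i \<in> A \<Longrightarrow> f i \<in> E) \<Longrightarrow> sum f A \<in> E"
  by (induction A rule: infinite_finite_induct) (auto intro: subfield_0 subfield_add)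

lemma subfield_prod: "is_subfield E \<Longrightarrow> (\<And>i. i \<in> A \<Longrightarrow> f i \<in> E) \<Longrightarrow> prod f A \<in> E"
  by (induction A rule: infinite_finite_induct) (auto intro: subfield_1 subfield_mult)

lemma subfield_power: "is_subfield E \<Longrightarrow> x \<in> E \<Longrightarrow> x ^ k \<in> E"
  by (induction k) (auto intro: subfield_1 subfield_mult)

lemma subfield_of_nat: "is_subfield E \<Longrightarrow> of_nat k \<in> E"
  by (induction k) (auto intro: subfield_0 subfield_1 subfield_add)

lemma subfield_of_int: "is_subfield E \<Longrightarrow> of_int k \<in> E"
  by (cases k rule: int_cases2) (auto intro: subfield_of_nat subfield_uminus)

lemmas subfield_closed = subfield_0 subfield_1 subfield_add subfield_mult subfield_uminus
  subfield_inverse subfield_diff subfield_divide subfield_sum subfield_prod subfield_power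
  subfield_of_nat subfield_of_int

lemma subfield_adjoin: "is_subfield (adjoin F S)"
  unfolding adjoin_def is_subfield_def by blast

lemma adjoin_base: "F \<subseteq> adjoin F S" and adjoin_generators: "S \<subseteq> adjoin F S"
  unfolding adjoin_def by blast+

lemma adjoin_least: "is_subfield L \<Longrightarrow> F \<subseteq> L \<Longrightarrow> S \<subseteq> L \<Longrightarrow> adjoin F S \<subseteq> L"
  unfolding adjoin_def by blast


subsection \<open>Polynomials with coefficients in a subfield\<close>

definition polys_over :: "'a::field set \<Rightarrow> 'a poly set" where
  "polys_over E = {p. \<forall>i. coeff p i \<in> E}"

lemma polys_over_coeff: "p \<in> polys_over E \<Longrightarrow> coeff p i \<in> E"
  by (simp add: polys_over_def)

lemma polys_over_mono: "E \<subseteq> F \<Longrightarrow> p \<in> polys_over E \<Longrightarrow> p \<in> polys_over F"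
  by (auto simp: polys_over_def)

lemma
  assumes "is_subfield E"
  shows polys_over_0: "0 \<in> polys_over E" and polys_over_1: "1 \<in> polys_over E"
    and polys_over_add: "p \<in> polys_over E \<Longrightarrow> q \<in> polys_over E \<Longrightarrow> p + q \<in> polys_over E"
    and polys_over_diff: "p \<in> polys_over E \<Longrightarrow> q \<in> polys_over E \<Longrightarrow> p - q \<in> polys_over E"
    and polys_over_uminus: "p \<in> polys_over E \<Longrightarrow> - p \<in> polys_over E"
    and polys_over_mult: "p \<in> polys_over E \<Longrightarrow> q \<in> polys_over E \<Longrightarrow> p * q \<in> polys_over E"
    and polys_over_smult: "c \<in> E \<Longrightarrow> p \<in> polys_over E \<Longrightarrow> Polynomial.smult c p \<in> polys_over E"
    and polys_over_monom: "c \<in> E \<Longrightarrow> monom c k \<in> polys_over E"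
    and polys_over_pderiv: "p \<in> polys_over E \<Longrightarrow> pderiv p \<in> polys_over E"
    and polys_over_pCons: "c \<in> E \<Longrightarrow> p \<in> polys_over E \<Longrightarrow> pCons c p \<in> polys_over E"
  using assms
  by (auto simp: polys_over_def coeff_mult coeff_pderiv coeff_pCons monom.rep_eq split: nat.splits
      intro!: subfield_closed[OF assms] simp flip: of_nat_Suc)

lemmas polys_over_closed = polys_over_0 polys_over_1 polys_over_add polys_over_diff
  polys_over_uminus polys_over_mult polys_over_smult polys_over_monom polys_over_pderiv
  polys_over_pCons

lemma poly_in_subfield:
  "is_subfield E \<Longrightarrow> p \<in> polys_over E \<Longrightarrow> x \<in> E \<Longrightarrow> poly p x \<in> E"
  by (auto simp: poly_altdef intro!: subfield_closed polys_over_coeff)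

text \<open>Long division by induction on the degree: cancelling the leading term of
  \<open>p\<close> by a multiple of \<open>P\<close> stays over \<open>E\<close>, because
  \<open>E\<close> contains the quotient of the two leading coefficients.\<close>

lemma polys_over_division:
  assumes E: "is_subfield E" and P: "P \<in> polys_over E" "P \<noteq> 0" and p: "p \<in> polys_over E"
  shows "\<exists>q\<in>polys_over E. \<exists>r\<in>polys_over E. p = P * q + r \<and> (r = 0 \<or> degree r < degree P)"
  using p
proof (induction "degree p" arbitrary: p rule: less_induct)
  case less
  show ?case
  proof (cases "p = 0 \<or> degree p < degree P")
    case True
    then show ?thesis
      using less.prems polys_over_0[OF E] by (intro bexI[of _ 0] bexI[of _ p]) auto
  next
    case False
    define t where "t = monom (lead_coeff p / lead_coeff P) (degree p - degree P)"
    have t: "t \<in> polys_over E"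
      unfolding t_def by (intro polys_over_closed E subfield_closed polys_over_coeff less.prems P)
    have lc: "lead_coeff p / lead_coeff P \<noteq> 0" using False P by auto
    have deg: "degree (P * t) = degree p"
      using False P lc by (simp add: t_def degree_mult_eq degree_monom_eq monom_eq_0_iff)
    have "lead_coeff t = lead_coeff p / lead_coeff P"
      using lc by (simp add: t_def degree_monom_eq)
    then have lcPt: "lead_coeff (P * t) = lead_coeff p"
      using P by (simp add: lead_coeff_mult)
    have s: "p - P * t \<in> polys_over E" by (intro polys_over_closed E less.prems P t)
    \<comment> \<open>The degree of a constant cannot drop, so for constant \<open>p\<close> the
      difference has to vanish.\<close>
    consider "p - P * t = 0" | "p - P * t \<noteq> 0" "degree (p - P * t) < degree p"
    proof (cases "degree p = 0")
      case True
      then have "p - P * t = 0"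
        using deg lcPt by (metis degree_0_id diff_self)
      then show ?thesis using that by blast
    next
      case False
      have "degree (p - P * t) \<le> degree p" using deg by (simp add: degree_diff_le)
      moreover have "coeff (p - P * t) (degree p) = 0" using deg lcPt by simp
      ultimately have "degree (p - P * t) < degree p"
        using False by (metis eq_zero_or_degree_less degree_0 le_neq_implies_less neq0_conv)
      then show ?thesis using that by blast
    qed
    then show ?thesis
    proof cases
      case 1
      then show ?thesis using t polys_over_0[OF E] by (intro bexI[of _ t] bexI[of _ 0]) auto
    next
      case 2
      from less.hyps[OF 2(2) s] obtain q r where qr: "q \<in> polys_over E" "r \<in> polys_over E"
        "p - P * t = P * q + r" "r = 0 \<or> degree r < degree P" by blast
      then have "p = P * (q + t) + r" by (simp add: algebra_simps)
      then show ?thesis using qr t polys_over_add[OF E qr(1) t] by blast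
    qed
  qed
qed


subsection \<open>Algebraic elements and simple extensions\<close>

definition algebraic_over :: "'a::field set \<Rightarrow> 'a \<Rightarrow> bool" where
  "algebraic_over E a \<longleftrightarrow> (\<exists>p\<in>polys_over E. p \<noteq> 0 \<and> poly p a = 0)"

text \<open>Not normalised to be monic, hence determined only up to a factor from the field
  \<open>E\<close>; divisibility and quotients such as the one in
  \<open>derivation_minimal_poly\<close> are insensitive to that factor.\<close>

definition minimal_poly :: "'a::field set \<Rightarrow> 'a \<Rightarrow> 'a poly \<Rightarrow> bool" where
  "minimal_poly E a P \<longleftrightarrow> P \<in> polys_over E \<and> P \<noteq> 0 \<and> poly P a = 0 \<and>
     (\<forall>q\<in>polys_over E. q \<noteq> 0 \<longrightarrow> poly q a = 0 \<longrightarrow> degree P \<le> degree q)"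

lemma minimal_poly_exists:
  assumes "algebraic_over E a"
  shows "\<exists>P. minimal_poly E a P"
proof -
  let ?Q = "\<lambda>p. p \<in> polys_over E \<and> p \<noteq> 0 \<and> poly p a = 0"
  obtain p where "?Q p" using assms by (auto simp: algebraic_over_def)
  from ex_has_least_nat[of ?Q p degree, OF this]
  show ?thesis unfolding minimal_poly_def by blast
qed

lemma minimal_poly_dvd:
  assumes E: "is_subfield E" and P: "minimal_poly E a P" and q: "q \<in> polys_over E" "poly q a = 0"
  shows "\<exists>r\<in>polys_over E. q = P * r"
proof -
  obtain s r where sr: "s \<in> polys_over E" "r \<in> polys_over E" "q = P * s + r"
    "r = 0 \<or> degree r < degree P"
    using polys_over_division[OF E _ _ q(1), of P] P by (auto simp: minimal_poly_def)
  then have "poly r a = 0" using q P by (auto simp: minimal_poly_def)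
  with sr P have "r = 0" unfolding minimal_poly_def by (meson not_less)
  then show ?thesis using sr by auto
qed

lemma minimal_poly_degree:
  assumes "minimal_poly E a P"
  shows "degree P > 0"
proof (rule ccontr)
  assume "\<not> degree P > 0"
  then obtain c where "P = [:c:]" by (metis degree_eq_zeroE neq0_conv)
  then show False using assms by (auto simp: minimal_poly_def)
qed

text \<open>Separability in characteristic 0: \<open>pderiv P\<close> is nonzero of smaller degree,
  so minimality keeps it from vanishing at \<open>a\<close>.\<close>

lemma minimal_poly_pderiv:
  fixes a :: "'a::field_char_0"
  assumes E: "is_subfield E" and P: "minimal_poly E a P"
  shows "poly (pderiv P) a \<noteq> 0"
proof
  assume "poly (pderiv P) a = 0"
  moreover have "pderiv P \<in> polys_over E" "pderiv P \<noteq> 0"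
    using P polys_over_pderiv[OF E] minimal_poly_degree[OF P]
    by (auto simp: minimal_poly_def pderiv_eq_0_iff)
  ultimately have "degree P \<le> degree (pderiv P)" using P by (auto simp: minimal_poly_def)
  then show False using minimal_poly_degree[OF P] by (simp add: degree_pderiv)
qed

text \<open>The ring \<open>E[a]\<close>, which is already the field \<open>E(a)\<close> when
  \<open>a\<close> is algebraic over \<open>E\<close>.\<close>

definition simple_ext :: "'a::field set \<Rightarrow> 'a \<Rightarrow> 'a set" where
  "simple_ext E a = {poly p a | p. p \<in> polys_over E}"

lemma simple_extI: "p \<in> polys_over E \<Longrightarrow> poly p a \<in> simple_ext E a"
  by (auto simp: simple_ext_def)

lemma simple_extE:
  assumes "x \<in> simple_ext E a" obtains p where "p \<in> polys_over E" "x = poly p a"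
  using assms by (auto simp: simple_ext_def)

lemma simple_ext_base: "is_subfield E \<Longrightarrow> E \<subseteq> simple_ext E a"
  using simple_extI[of "[:_:]" E a] by (auto intro: polys_over_closed)

lemma simple_ext_generator: "is_subfield E \<Longrightarrow> a \<in> simple_ext E a"
  using simple_extI[of "[:0,1:]" E a] by (auto intro: polys_over_closed subfield_closed)

text \<open>Euclid's algorithm: dividing \<open>P\<close> by \<open>p\<close> gives
  \<open>p(a) q(a) = - r(a)\<close>, which reduces the inverse of \<open>p(a)\<close> to that of
  \<open>r(a)\<close>, where \<open>r\<close> has lower degree.\<close>

lemma simple_ext_inverse:
  assumes E: "is_subfield E" and P: "minimal_poly E a P"
    and p: "p \<in> polys_over E" "poly p a \<noteq> 0" "degree p < degree P"
  shows "inverse (poly p a) \<in> simple_ext E a"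
  using p
proof (induction "degree p" arbitrary: p rule: less_induct)
  case less
  have PE: "P \<in> polys_over E" and P0: "P \<noteq> 0" "poly P a = 0" using P by (auto simp: minimal_poly_def)
  show ?case
  proof (cases "degree p = 0")
    case True
    then obtain c where c: "p = [:c:]" by (metis degree_eq_zeroE)
    then have "c \<in> E" using polys_over_coeff[OF less.prems(1), of 0] by simp
    then show ?thesis using simple_ext_base[OF E] subfield_inverse[OF E] c by auto
  next
    case False
    have p0: "p \<noteq> 0" using less.prems by auto
    obtain q r where qr: "q \<in> polys_over E" "r \<in> polys_over E" "P = p * q + r"
      "r = 0 \<or> degree r < degree p"
      using polys_over_division[OF E less.prems(1) p0 PE] by blast
    have eq: "poly p a * poly q a + poly r a = 0" using P0 qr(3) by auto
    \<comment> \<open>If \<open>r(a) = 0\<close> then also \<open>q(a) = 0\<close>, and either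
      \<open>r\<close> or, for \<open>r = 0\<close>, the cofactor \<open>q\<close> would be a
      nonzero annihilator of degree below that of \<open>P\<close>.\<close>
    have ra: "poly r a \<noteq> 0"
    proof
      assume r0: "poly r a = 0"
      then have "poly q a = 0" using eq less.prems by simp
      show False
      proof (cases "r = 0")
        case True
        then have "q \<noteq> 0" "degree P = degree p + degree q"
          using qr(3) P0 p0 by (auto simp: degree_mult_eq)
        then show False using P \<open>poly q a = 0\<close> qr(1) False by (auto simp: minimal_poly_def)
      next
        case False
        then have "degree P \<le> degree r" using P r0 qr(2) by (auto simp: minimal_poly_def)
        then show False using qr(4) False less.prems(3) by auto
      qed
    qed
    then have "inverse (poly r a) \<in> simple_ext E a" using less.hyps[OF _ qr(2)] qr(4) less.prems(3) by fastforce
    then obtain s where s: "s \<in> polys_over E" "inverse (poly r a) = poly s a" by (rule simple_extE)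
    have "poly p a * poly (- (q * s)) a = 1"
    proof -
      have "poly p a * poly (- (q * s)) a = - (poly p a * poly q a) * inverse (poly r a)"
        by (simp add: s(2))
      also have "- (poly p a * poly q a) = poly r a" using eq by (simp add: add_eq_0_iff)
      finally show ?thesis using ra by simp
    qed
    then have "inverse (poly p a) = poly (- (q * s)) a" by (metis inverse_unique)
    moreover have "- (q * s) \<in> polys_over E" by (intro polys_over_closed E qr s)
    ultimately show ?thesis using simple_extI[of "- (q * s)" E a] by simp
  qed
qed

lemma subfield_simple_ext:
  assumes E: "is_subfield E" and a: "algebraic_over E a"
  shows "is_subfield (simple_ext E a)"
proof -
  obtain P where P: "minimal_poly E a P" using minimal_poly_exists[OF a] by blast
  have inv: "inverse x \<in> simple_ext E a" if x: "x \<in> simple_ext E a" for x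
  proof -
    obtain p where p: "p \<in> polys_over E" "x = poly p a" using x by (rule simple_extE)
    obtain q r where qr: "r \<in> polys_over E" "p = P * q + r" "r = 0 \<or> degree r < degree P"
      using polys_over_division[OF E _ _ p(1), of P] P by (auto simp: minimal_poly_def)
    then have xr: "x = poly r a" using p P by (simp add: minimal_poly_def)
    then show ?thesis
      using simple_ext_inverse[OF E P qr(1)] qr x by (cases "x = 0") auto
  qed
  have "x + y \<in> simple_ext E a \<and> x * y \<in> simple_ext E a \<and> - x \<in> simple_ext E a"
    if xy: "x \<in> simple_ext E a" "y \<in> simple_ext E a" for x y
  proof -
    obtain p q where "p \<in> polys_over E" "q \<in> polys_over E" "x = poly p a" "y = poly q a"
      using xy unfolding simple_ext_def by blast
    then show ?thesis
      using simple_extI[of "p + q" E a] simple_extI[of "p * q" E a] simple_extI[of "- p" E a]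
        polys_over_add[OF E, of p q] polys_over_mult[OF E, of p q] polys_over_uminus[OF E, of p]
      by simp
  qed
  moreover have "0 \<in> simple_ext E a" "1 \<in> simple_ext E a"
    using subfield_0[OF E] subfield_1[OF E] simple_ext_base[OF E, of a] by blast+
  ultimately show ?thesis
    using inv unfolding is_subfield_def by simp
qed


subsection \<open>Derivations\<close>

text \<open>A derivation from \<open>E\<close> into the ambient field: its values need not lie in
  \<open>E\<close>, and off \<open>E\<close> the function is arbitrary.\<close>

definition derivation_on :: "'a::field set \<Rightarrow> ('a \<Rightarrow> 'a) \<Rightarrow> bool" where
  "derivation_on E d \<longleftrightarrow>
     (\<forall>x\<in>E. \<forall>y\<in>E. d (x + y) = d x + d y \<and> d (x * y) = d x * y + x * d y)"

context
  fixes E :: "'a::field set" and d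
  assumes E: "is_subfield E" and d: "derivation_on E d"
begin

lemma derivation_add: "x \<in> E \<Longrightarrow> y \<in> E \<Longrightarrow> d (x + y) = d x + d y"
  and derivation_mult: "x \<in> E \<Longrightarrow> y \<in> E \<Longrightarrow> d (x * y) = d x * y + x * d y"
  using d by (auto simp: derivation_on_def)

lemma derivation_0: "d 0 = 0"
  using derivation_add[of 0 0] subfield_0[OF E] by (metis add_0 add_cancel_right_right)

lemma derivation_1: "d 1 = 0"
  using derivation_mult[of 1 1] subfield_1[OF E]
  by (metis add_cancel_right_right mult_1 mult_1_right)

lemma derivation_uminus: "x \<in> E \<Longrightarrow> d (- x) = - d x"
  using derivation_add[of x "- x"] subfield_uminus[OF E, of x]
  by (simp add: derivation_0 eq_neg_iff_add_eq_0 add.commute)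

lemma derivation_inverse: "x \<in> E \<Longrightarrow> x \<noteq> 0 \<Longrightarrow> d (inverse x) = - d x / x ^ 2"
  using derivation_mult[of x "inverse x"] subfield_inverse[OF E, of x] derivation_1
  by (simp add: field_simps power2_eq_square eq_neg_iff_add_eq_0)

lemma derivation_divide:
  assumes "x \<in> E" "y \<in> E" "y \<noteq> 0"
  shows "d (x / y) = (d x * y - x * d y) / y ^ 2"
proof -
  have "d (x / y) = d x * inverse y + x * (- d y / y ^ 2)"
    using derivation_mult[of x "inverse y"] subfield_inverse[OF E, of y] assms
    by (simp add: derivation_inverse divide_inverse)
  then show ?thesis using assms(3) by (simp add: field_simps power2_eq_square)
qed

lemma derivation_sum: "(\<And>i. i \<in> A \<Longrightarrow> f i \<in> E) \<Longrightarrow> d (sum f A) = (\<Sum>i\<in>A. d (f i))"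
  by (induction A rule: infinite_finite_induct)
    (auto simp: derivation_0 derivation_add subfield_sum[OF E])

lemma derivation_prod:
  "finite A \<Longrightarrow> (\<And>i. i \<in> A \<Longrightarrow> f i \<in> E) \<Longrightarrow>
    d (prod f A) = (\<Sum>i\<in>A. d (f i) * prod f (A - {i}))"
proof (induction A rule: finite_induct)
  case empty
  then show ?case by (simp add: derivation_1)
next
  case (insert a A)
  have "prod f (insert a A - {i}) = f a * prod f (A - {i})" if "i \<in> A" for i
  proof -
    have "insert a A - {i} = insert a (A - {i})" using that insert by auto
    then show ?thesis using insert by simp
  qed
  then have "(\<Sum>i\<in>A. d (f i) * prod f (insert a A - {i})) = f a * (\<Sum>i\<in>A. d (f i) * prod f (A - {i}))"
    by (simp add: sum_distrib_left mult_ac)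
  moreover have "insert a A - {a} = A" using insert by auto
  ultimately show ?case
    using insert by (simp add: derivation_mult subfield_prod[OF E])
qed

text \<open>Chain rule: \<open>map_poly d p\<close> differentiates the coefficients,
  \<open>pderiv p\<close> the variable.\<close>

lemma derivation_poly:
  "p \<in> polys_over E \<Longrightarrow> a \<in> E \<Longrightarrow> d (poly p a) = poly (map_poly d p) a + poly (pderiv p) a * d a"
proof (induction p)
  case 0
  then show ?case by (simp add: derivation_0)
next
  case (pCons c p)
  have c: "c \<in> E" and p: "p \<in> polys_over E"
    using pCons.prems(1) by (auto simp: polys_over_def coeff_pCons split: nat.splits)
  have "d (poly (pCons c p) a) = d c + (d a * poly p a + a * d (poly p a))"
    using c p pCons.prems by (simp add: derivation_add derivation_mult subfield_mult[OF E] poly_in_subfield[OF E])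
  then show ?case
    using p pCons by (simp add: map_poly_pCons derivation_0 pderiv_pCons algebra_simps)
qed

lemma map_poly_derivation_add:
  "p \<in> polys_over E \<Longrightarrow> q \<in> polys_over E \<Longrightarrow> map_poly d (p + q) = map_poly d p + map_poly d q"
  by (rule poly_eqI) (simp add: coeff_map_poly derivation_0 derivation_add polys_over_coeff)

lemma map_poly_derivation_mult:
  assumes "p \<in> polys_over E" "q \<in> polys_over E"
  shows "map_poly d (p * q) = map_poly d p * q + p * map_poly d q"
proof (rule poly_eqI)
  fix k
  have "d (coeff (p * q) k) = (\<Sum>i\<le>k. d (coeff p i * coeff q (k - i)))"
    unfolding coeff_mult by (rule derivation_sum) (intro subfield_closed E polys_over_coeff assms)
  also have "\<dots> = (\<Sum>i\<le>k. d (coeff p i) * coeff q (k - i) + coeff p i * d (coeff q (k - i)))"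
    using assms by (simp add: derivation_mult polys_over_coeff)
  finally show "coeff (map_poly d (p * q)) k = coeff (map_poly d p * q + p * map_poly d q) k"
    by (simp add: coeff_map_poly derivation_0 coeff_mult sum.distrib)
qed

end

text \<open>Differentiate \<open>P(a) = 0\<close> by the chain rule and solve for
  \<open>d a\<close>. The value at an algebraic element is thus forced by the values on
  \<open>E\<close>.\<close>

lemma derivation_minimal_poly:
  fixes a :: "'a::field_char_0"
  assumes E: "is_subfield E" and P: "minimal_poly E a P"
    and L: "is_subfield L" "derivation_on L d" "E \<subseteq> L" "a \<in> L"
  shows "d a = - poly (map_poly d P) a / poly (pderiv P) a"
proof -
  have "P \<in> polys_over L" using P L(3) by (auto simp: minimal_poly_def polys_over_def)
  then have "poly (map_poly d P) a + poly (pderiv P) a * d a = 0"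
    using derivation_poly[OF L(1,2) _ L(4), of P] P derivation_0[OF L(1,2)]
    by (auto simp: minimal_poly_def)
  then show ?thesis
    using minimal_poly_pderiv[OF E P] by (simp add: field_simps eq_neg_iff_add_eq_0)
qed

text \<open>\<open>\<Phi>\<close> differentiates polynomials evaluated at \<open>a\<close> as if
  \<open>a\<close> had derivative \<open>b\<close>. With the forced value for \<open>b\<close> it
  kills \<open>P\<close> and, as \<open>P(a) = 0\<close>, all multiples of \<open>P\<close>; so it
  depends only on the value at \<open>a\<close>.\<close>

lemma derivation_simple_ext:
  fixes a :: "'a::field_char_0"
  assumes E: "is_subfield E" and d: "derivation_on E d" and a: "algebraic_over E a"
  shows "\<exists>d'. derivation_on (simple_ext E a) d' \<and> (\<forall>x\<in>E. d' x = d x)"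
proof -
  obtain P where P: "minimal_poly E a P" using minimal_poly_exists[OF a] by blast
  have PE: "P \<in> polys_over E" using P by (simp add: minimal_poly_def)
  define b where "b = - poly (map_poly d P) a / poly (pderiv P) a"
  define \<Phi> where "\<Phi> p = poly (map_poly d p) a + poly (pderiv p) a * b" for p
  have add: "\<Phi> (p + q) = \<Phi> p + \<Phi> q" if "p \<in> polys_over E" "q \<in> polys_over E" for p q
    using that by (simp add: \<Phi>_def map_poly_derivation_add[OF E d] pderiv_add algebra_simps)
  have mult: "\<Phi> (p * q) = \<Phi> p * poly q a + poly p a * \<Phi> q"
    if "p \<in> polys_over E" "q \<in> polys_over E" for p q
    using that by (simp add: \<Phi>_def map_poly_derivation_mult[OF E d] pderiv_mult algebra_simps)
  have "\<Phi> P = 0" using minimal_poly_pderiv[OF E P] by (simp add: \<Phi>_def b_def)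
  have wd: "\<Phi> p = \<Phi> q" if pq: "p \<in> polys_over E" "q \<in> polys_over E" "poly p a = poly q a" for p q
  proof -
    obtain r where r: "r \<in> polys_over E" "p - q = P * r"
      using minimal_poly_dvd[OF E P polys_over_diff[OF E pq(1,2)]] pq(3) by auto
    then have "p = q + P * r" by (simp add: algebra_simps)
    then have "\<Phi> p = \<Phi> q + \<Phi> (P * r)" using add[OF pq(2) polys_over_mult[OF E PE r(1)]] by simp
    moreover have "\<Phi> (P * r) = 0"
      using mult[OF PE r(1)] \<open>\<Phi> P = 0\<close> P by (simp add: minimal_poly_def)
    ultimately show ?thesis by simp
  qed
  define d' where "d' u = \<Phi> (SOME p. p \<in> polys_over E \<and> poly p a = u)" for u
  have d': "d' (poly p a) = \<Phi> p" if p: "p \<in> polys_over E" for p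
  proof -
    have "(SOME q. q \<in> polys_over E \<and> poly q a = poly p a) \<in> polys_over E \<and>
        poly (SOME q. q \<in> polys_over E \<and> poly q a = poly p a) a = poly p a"
      by (rule someI[of _ p]) (simp add: p)
    then show ?thesis unfolding d'_def using wd p by blast
  qed
  have "d' (x + y) = d' x + d' y \<and> d' (x * y) = d' x * y + x * d' y"
    if xy: "x \<in> simple_ext E a" "y \<in> simple_ext E a" for x y
  proof -
    obtain p q where pq: "p \<in> polys_over E" "q \<in> polys_over E" "x = poly p a" "y = poly q a"
      using xy unfolding simple_ext_def by blast
    have "d' (x + y) = \<Phi> (p + q)" using d'[OF polys_over_add[OF E pq(1,2)]] pq by simp
    moreover have "d' (x * y) = \<Phi> (p * q)" using d'[OF polys_over_mult[OF E pq(1,2)]] pq by simp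
    ultimately show ?thesis using add[OF pq(1,2)] mult[OF pq(1,2)] d'[OF pq(1)] d'[OF pq(2)] pq
      by simp
  qed
  moreover have "d' x = d x" if x: "x \<in> E" for x
    using d'[of "[:x:]"] polys_over_pCons[OF E x polys_over_0[OF E]]
    by (simp add: \<Phi>_def map_poly_pCons derivation_0[OF E d])
  ultimately show ?thesis unfolding derivation_on_def by blast
qed

lemma algebraic_over_mono: "algebraic_over E a \<Longrightarrow> E \<subseteq> F \<Longrightarrow> algebraic_over F a"
  unfolding algebraic_over_def using polys_over_mono by blast

text \<open>Since each value is forced, \<open>\<theta>\<close> can be written down pointwise. The
  derivation laws for \<open>x\<close> and \<open>y\<close> are checked in the tower
  \<open>E(x)(y)\<close>: there \<open>d\<close> extends in two simple steps, and by
  \<open>eq\<close> the extension coincides with \<open>\<theta>\<close>.\<close>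

lemma derivation_algebraic_ext:
  fixes d :: "'a::field_char_0 \<Rightarrow> 'a"
  assumes E: "is_subfield E" and d: "derivation_on E d" and alg: "\<And>a. algebraic_over E a"
  shows "\<exists>\<theta>. derivation_on UNIV \<theta> \<and> (\<forall>x\<in>E. \<theta> x = d x)"
proof -
  have "\<forall>a. \<exists>P. minimal_poly E a P" using minimal_poly_exists[OF alg] by blast
  then obtain P where P: "\<And>a. minimal_poly E a (P a)" by metis
  define \<theta> where "\<theta> a = - poly (map_poly d (P a)) a / poly (pderiv (P a)) a" for a
  have eq: "d' a = \<theta> a" if L: "is_subfield L" "derivation_on L d'" "E \<subseteq> L" "a \<in> L"
    and d': "\<forall>x\<in>E. d' x = d x" for d' L a
  proof -
    have "map_poly d' (P a) = map_poly d (P a)"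
      using P[of a] d' derivation_0[OF L(1,2)] derivation_0[OF E d]
      by (intro poly_eqI) (simp add: coeff_map_poly minimal_poly_def polys_over_def)
    then show ?thesis using derivation_minimal_poly[OF E P L] by (simp add: \<theta>_def)
  qed
  have "\<theta> (x + y) = \<theta> x + \<theta> y \<and> \<theta> (x * y) = \<theta> x * y + x * \<theta> y" for x y
  proof -
    define L M where "L = simple_ext E x" and "M = simple_ext L y"
    have L: "is_subfield L" "E \<subseteq> L" "x \<in> L"
      unfolding L_def by (rule subfield_simple_ext[OF E alg] simple_ext_base[OF E] simple_ext_generator[OF E])+
    have yL: "algebraic_over L y" using algebraic_over_mono[OF alg L(2)] .
    have M: "is_subfield M" "L \<subseteq> M" "y \<in> M"
      unfolding M_def by (rule subfield_simple_ext[OF L(1) yL] simple_ext_base[OF L(1)] simple_ext_generator[OF L(1)])+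
    obtain d1 where d1: "derivation_on L d1" "\<forall>x\<in>E. d1 x = d x"
      using derivation_simple_ext[OF E d alg] L_def by blast
    obtain d2 where d2: "derivation_on M d2" "\<forall>x\<in>L. d2 x = d1 x"
      using derivation_simple_ext[OF L(1) d1(1) yL] M_def by blast
    have "\<forall>x\<in>E. d2 x = d x" using d1 d2 L(2) by auto
    then have d2eq: "d2 z = \<theta> z" if "z \<in> M" for z
      using eq[OF M(1) d2(1) _ that] L(2) M(2) by auto
    have xy: "x \<in> M" "y \<in> M" using L M by auto
    then show ?thesis
      using derivation_add[OF M(1) d2(1) xy] derivation_mult[OF M(1) d2(1) xy]
        d2eq[OF xy(1)] d2eq[OF xy(2)] d2eq[OF subfield_add[OF M(1) xy]] d2eq[OF subfield_mult[OF M(1) xy]]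
      by simp
  qed
  then have "derivation_on UNIV \<theta>" unfolding derivation_on_def by blast
  moreover have "\<theta> x = d x" if "x \<in> E" for x using eq[OF E d _ that] by simp
  ultimately show ?thesis by blast
qed

lemma subfield_UNIV: "is_subfield UNIV"
  by (simp add: is_subfield_def)

lemma derivation_algebraic_eq_0:
  fixes a :: "'a::field_char_0"
  assumes E: "is_subfield E" and d: "derivation_on UNIV d" and "\<forall>x\<in>E. d x = 0"
    and a: "algebraic_over E a"
  shows "d a = 0"
proof -
  obtain P where P: "minimal_poly E a P" using minimal_poly_exists[OF a] by blast
  have "map_poly d P = 0"
    using P assms(3) derivation_0[OF subfield_UNIV d]
    by (intro poly_eqI) (simp add: coeff_map_poly minimal_poly_def polys_over_def)
  then show ?thesis using derivation_minimal_poly[OF E P subfield_UNIV d] by simp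
qed

text \<open>The forced value of \<open>d a\<close> is a quotient of polynomials in \<open>a\<close>
  over \<open>E\<close>, hence lies in \<open>E(a)\<close>.\<close>

lemma derivation_stable_simple_ext:
  fixes a :: "'a::field_char_0"
  assumes E: "is_subfield E" and d: "derivation_on UNIV d" and st: "\<forall>x\<in>E. d x \<in> E"
    and a: "algebraic_over E a" and x: "x \<in> simple_ext E a"
  shows "d x \<in> simple_ext E a"
proof -
  note L = subfield_simple_ext[OF E a]
  have d0: "d 0 = 0" by (rule derivation_0[OF subfield_UNIV d])
  have map: "map_poly d p \<in> polys_over (simple_ext E a)" if "p \<in> polys_over E" for p
    using that st simple_ext_base[OF E, of a] by (auto simp: polys_over_def coeff_map_poly d0)
  have in_L: "p \<in> polys_over (simple_ext E a)" if "p \<in> polys_over E" for p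
    using that polys_over_mono[OF simple_ext_base[OF E]] by blast
  obtain P where P: "minimal_poly E a P" using minimal_poly_exists[OF a] by blast
  then have PE: "P \<in> polys_over E" by (simp add: minimal_poly_def)
  note ga = simple_ext_generator[OF E, of a]
  have da: "d a \<in> simple_ext E a"
    unfolding derivation_minimal_poly[OF E P subfield_UNIV d subset_UNIV UNIV_I]
    by (intro subfield_closed[OF L] poly_in_subfield[OF L] map in_L polys_over_pderiv[OF E] PE ga)
  obtain p where p: "p \<in> polys_over E" "x = poly p a" using x by (rule simple_extE)
  have "p \<in> polys_over UNIV" by (simp add: polys_over_def)
  from derivation_poly[OF subfield_UNIV d this UNIV_I] show ?thesis
    unfolding p(2)
    by (simp only:) (intro subfield_closed[OF L] poly_in_subfield[OF L] map in_L polys_over_pderiv[OF E] p da ga)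
qed


subsection \<open>Linear algebra over finite index sets\<close>

text \<open>Gaussian elimination, one coordinate \<open>s\<close> per induction step, with a vector
  \<open>v j\<close> that is nonzero at \<open>s\<close> as the pivot.\<close>

lemma linear_dependence_of_many_vectors:
  fixes v :: "'i \<Rightarrow> 's \<Rightarrow> 'k::field"
  assumes "finite S" "finite I" "card S < card I"
  shows "\<exists>a. (\<exists>i\<in>I. a i \<noteq> 0) \<and> (\<forall>s\<in>S. (\<Sum>i\<in>I. a i * v i s) = 0)"
  using assms
proof (induction S arbitrary: I v rule: finite_induct)
  case empty
  then obtain i where "i \<in> I" by fastforce
  then show ?case by (intro exI[of _ "\<lambda>_. 1"]) auto
next
  case (insert s S)
  show ?case
  proof (cases "\<forall>i\<in>I. v i s = 0")
    case True
    have "card S < card I" using insert by simp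
    then obtain a where "\<exists>i\<in>I. a i \<noteq> 0" "\<forall>t\<in>S. (\<Sum>i\<in>I. a i * v i t) = 0"
      using insert.IH[OF insert.prems(1), of v] by blast
    then show ?thesis using True by auto
  next
    case False
    then obtain j where j: "j \<in> I" "v j s \<noteq> 0" by blast
    define u where "u i t = v i t - v i s / v j s * v j t" for i t
    have "card S < card (I - {j})" using insert j by simp
    then obtain a where a: "\<exists>i\<in>I - {j}. a i \<noteq> 0" "\<forall>t\<in>S. (\<Sum>i\<in>I - {j}. a i * u i t) = 0"
      using insert.IH[of "I - {j}" u] insert.prems by auto
    \<comment> \<open>The pivot's coefficient collects the multiples of \<open>v j\<close> that were
      subtracted in \<open>u\<close>.\<close>
    define b where "b = a(j := - (\<Sum>i\<in>I - {j}. a i * v i s) / v j s)"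
    have eq: "(\<Sum>i\<in>I. b i * v i t) = (\<Sum>i\<in>I - {j}. a i * u i t)" for t
    proof -
      have "(\<Sum>i\<in>I. b i * v i t) = b j * v j t + (\<Sum>i\<in>I - {j}. b i * v i t)"
        using j insert.prems by (simp add: sum.remove)
      also have "(\<Sum>i\<in>I - {j}. b i * v i t) = (\<Sum>i\<in>I - {j}. a i * v i t)"
        by (intro sum.cong) (auto simp: b_def)
      also have "b j * v j t = - (\<Sum>i\<in>I - {j}. a i * (v i s / v j s * v j t))"
        by (simp add: b_def sum_distrib_right sum_distrib_left sum_divide_distrib mult_ac)
      finally show ?thesis by (simp add: u_def algebra_simps sum_subtractf)
    qed
    have "u i s = 0" for i using j by (simp add: u_def)
    then have "\<forall>t\<in>insert s S. (\<Sum>i\<in>I. b i * v i t) = 0" using eq a(2) by simp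
    moreover have "\<exists>i\<in>I. b i \<noteq> 0" using a(1) by (auto simp: b_def)
    ultimately show ?thesis by blast
  qed
qed

text \<open>Used for a space of rational vectors and, over the field itself, for the vectors
  \<open>u(\<delta>)\<close>. Once \<open>W\<close> fills the coordinates in \<open>J\<close>, the
  new coordinate \<open>j\<close> is either free on \<open>W\<close> or a linear function of the
  others, and that function is the annihilator.\<close>

lemma annihilator_or_surjective:
  fixes W :: "('i \<Rightarrow> 'k::field) set"
  assumes "finite I"
    and add: "\<And>f g. f \<in> W \<Longrightarrow> g \<in> W \<Longrightarrow> (\<lambda>i. f i + g i) \<in> W"
    and scale: "\<And>a f. f \<in> W \<Longrightarrow> (\<lambda>i. a * f i) \<in> W" and ne: "W \<noteq> {}"
  shows "(\<exists>w. (\<exists>i\<in>I. w i \<noteq> 0) \<and> (\<forall>f\<in>W. (\<Sum>i\<in>I. w i * f i) = 0)) \<or>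
    (\<forall>g. \<exists>f\<in>W. \<forall>i\<in>I. f i = g i)"
  using assms(1)
proof (induction I rule: finite_induct)
  case empty
  then show ?case using ne by auto
next
  case (insert j J)
  show ?case
  proof (cases "\<forall>g. \<exists>f\<in>W. \<forall>i\<in>J. f i = g i")
    case False
    then obtain w where w: "\<exists>i\<in>J. w i \<noteq> 0" "\<forall>f\<in>W. (\<Sum>i\<in>J. w i * f i) = 0"
      using insert.IH by blast
    define w' where "w' = w(j := 0)"
    have "(\<Sum>i\<in>insert j J. w' i * f i) = (\<Sum>i\<in>J. w i * f i)" for f
    proof -
      have "(\<Sum>i\<in>J. w' i * f i) = (\<Sum>i\<in>J. w i * f i)"
        using insert.hyps by (intro sum.cong) (auto simp: w'_def)
      then show ?thesis using insert.hyps by (simp add: w'_def)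
    qed
    moreover have "\<exists>i\<in>insert j J. w' i \<noteq> 0" using w insert.hyps by (auto simp: w'_def)
    ultimately show ?thesis using w(2) by auto
  next
    case surj: True
    have sum: "(\<lambda>i. \<Sum>k\<in>A. a k * h k i) \<in> W" if h: "\<And>k. k \<in> J \<Longrightarrow> h k \<in> W" and "A \<subseteq> J" for A a h
    proof -
      have "finite A" using that insert.hyps finite_subset by blast
      then show ?thesis using \<open>A \<subseteq> J\<close>
      proof (induction A rule: finite_induct)
        case empty
        obtain f where "f \<in> W" using ne by blast
        from scale[OF this, of 0] show ?case by simp
      next
        case (insert k A)
        then show ?case using add[OF scale[OF h, of k "a k"]] by auto
      qed
    qed
    show ?thesis
    proof (cases "\<exists>f\<in>W. (\<forall>i\<in>J. f i = 0) \<and> f j \<noteq> 0")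
      case True
      then obtain f where f: "f \<in> W" "\<forall>i\<in>J. f i = 0" "f j \<noteq> 0" by blast
      have "\<exists>h\<in>W. \<forall>i\<in>insert j J. h i = g i" for g
      proof -
        obtain h where h: "h \<in> W" "\<forall>i\<in>J. h i = g i" using surj by blast
        then have "(\<lambda>i. h i + (g j - h j) / f j * f i) \<in> W" using add scale f by blast
        then show ?thesis using h f by (intro bexI) auto
      qed
      then show ?thesis by blast
    next
      case False
      \<comment> \<open>The \<open>h k\<close> restrict to the unit vectors on \<open>J\<close>. An
        element of \<open>W\<close> is determined at \<open>j\<close> by its values on
        \<open>J\<close>, so \<open>w\<close> encodes that \<open>f j\<close> is the sum of the
        \<open>f k * h k j\<close>.\<close>
      have "\<forall>k. \<exists>f\<in>W. \<forall>i\<in>J. f i = (if i = k then 1 else 0)" using surj by (rule_tac allI) (erule spec)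
      then obtain h where h: "\<And>k. h k \<in> W" "\<And>k i. i \<in> J \<Longrightarrow> h k i = (if i = k then 1 else 0)" by metis
      define w where "w i = (if i = j then -1 else h i j)" for i
      have "(\<Sum>i\<in>insert j J. w i * f i) = 0" if f: "f \<in> W" for f
      proof -
        define r where "r = (\<lambda>i. f i + (-1) * (\<Sum>k\<in>J. f k * h k i))"
        have "r \<in> W" unfolding r_def by (rule add[OF f scale[OF sum]]) (simp_all add: h)
        moreover have "r i = 0" if "i \<in> J" for i
        proof -
          have "(\<Sum>k\<in>J. f k * h k i) = (\<Sum>k\<in>J. if k = i then f i else 0)"
            using that by (intro sum.cong) (auto simp: h)
          then show ?thesis using that insert.hyps by (simp add: r_def)
        qed
        ultimately have "r j = 0" using False by blast
        moreover have "(\<Sum>i\<in>J. w i * f i) = (\<Sum>k\<in>J. f k * h k j)"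
          using insert.hyps by (intro sum.cong) (auto simp: w_def)
        ultimately show ?thesis using insert.hyps by (simp add: r_def w_def)
      qed
      moreover have "\<exists>i\<in>insert j J. w i \<noteq> 0" by (auto simp: w_def)
      ultimately show ?thesis by blast
    qed
  qed
qed


subsection \<open>Algebraic independence\<close>

lemma alg_indep_over_empty: "alg_indep_over F {}"
  unfolding alg_indep_over_def
proof (intro allI impI)
  fix P :: "('a \<Rightarrow>\<^sub>0 nat) \<Rightarrow>\<^sub>0 'a"
  assume keys: "\<forall>\<mu>\<in>Poly_Mapping.keys P. Poly_Mapping.keys \<mu> \<subseteq> {}" and ev: "eval_at_names P = 0"
  have "Poly_Mapping.keys P \<subseteq> {0}" using keys by auto
  then consider "Poly_Mapping.keys P = {}" | "Poly_Mapping.keys P = {0}" by blast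
  then show "P = 0"
  proof cases
    case 2
    then have "Poly_Mapping.lookup P 0 = 0" using ev by (simp add: eval_at_names_def)
    then show ?thesis using 2 by (metis in_keys_iff singletonI)
  qed simp
qed

text \<open>Grouping a relation by the exponent of \<open>g\<close> turns it into a polynomial equation for \<open>g\<close>
  whose coefficients are themselves relations among the elements of \<open>S\<close>.\<close>

lemma alg_indep_over_insert:
  fixes g :: "'a::field"
  assumes F: "is_subfield F" and S: "alg_indep_over F S" "finite S" and g: "\<not> algebraic_over (adjoin F S) g"
  shows "alg_indep_over F (insert g S)"
  unfolding alg_indep_over_def
proof (intro allI impI, rule ccontr)
  fix P :: "('a \<Rightarrow>\<^sub>0 nat) \<Rightarrow>\<^sub>0 'a"
  assume co: "\<forall>\<mu>. Poly_Mapping.lookup P \<mu> \<in> F"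
    and keys: "\<forall>\<mu>\<in>Poly_Mapping.keys P. Poly_Mapping.keys \<mu> \<subseteq> insert g S"
    and ev: "eval_at_names P = 0" and "P \<noteq> 0"
  let ?L = "adjoin F S"
  note L = subfield_adjoin[of F S]
  have "g \<notin> S"
  proof
    assume "g \<in> S"
    then have "g \<in> ?L" using adjoin_generators by blast
    then have "[:-g, 1:] \<in> polys_over ?L" using L by (intro polys_over_closed subfield_closed)
    then have "algebraic_over ?L g" unfolding algebraic_over_def by (intro bexI) auto
    then show False using g by simp
  qed
  obtain \<mu>0 where \<mu>0: "\<mu>0 \<in> Poly_Mapping.keys P" using \<open>P \<noteq> 0\<close> by (metis keys_eq_empty all_not_in_conv)
  let ?e = "\<lambda>\<mu>. Poly_Mapping.lookup \<mu> g"
  define mon where "mon \<mu> = (\<Prod>s\<in>S. s ^ Poly_Mapping.lookup \<mu> s)" for \<mu> :: "'a \<Rightarrow>\<^sub>0 nat"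
  define K where "K j = {\<mu> \<in> Poly_Mapping.keys P. ?e \<mu> = j}" for j
  define q where "q j = (\<Sum>\<mu>\<in>K j. Poly_Mapping.lookup P \<mu> * mon \<mu>)" for j
  define N where "N = Max (?e ` Poly_Mapping.keys P)"
  have eN: "?e \<mu> \<le> N" if "\<mu> \<in> Poly_Mapping.keys P" for \<mu> using that by (simp add: N_def)
  have full: "(\<Prod>s\<in>Poly_Mapping.keys \<mu>. s ^ Poly_Mapping.lookup \<mu> s) = mon \<mu> * g ^ ?e \<mu>"
    if "\<mu> \<in> Poly_Mapping.keys P" for \<mu>
  proof -
    have "(\<Prod>s\<in>Poly_Mapping.keys \<mu>. s ^ Poly_Mapping.lookup \<mu> s) =
        (\<Prod>s\<in>insert g S. s ^ Poly_Mapping.lookup \<mu> s)"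
      using keys that S(2) by (intro prod.mono_neutral_left) (auto simp: in_keys_iff)
    then show ?thesis using S(2) \<open>g \<notin> S\<close> by (simp add: mon_def mult.commute)
  qed
  have "eval_at_names P = (\<Sum>\<mu>\<in>Poly_Mapping.keys P. Poly_Mapping.lookup P \<mu> * mon \<mu> * g ^ ?e \<mu>)"
    unfolding eval_at_names_def by (intro sum.cong) (simp_all add: full mult.assoc)
  also have "\<dots> = (\<Sum>j\<le>N. \<Sum>\<mu>\<in>K j. Poly_Mapping.lookup P \<mu> * mon \<mu> * g ^ ?e \<mu>)"
    unfolding K_def by (rule sum.group[symmetric]) (auto intro: eN)
  also have "\<dots> = (\<Sum>j\<le>N. q j * g ^ j)"
    unfolding q_def sum_distrib_right by (intro sum.cong) (auto simp: K_def)
  finally have rel: "(\<Sum>j\<le>N. q j * g ^ j) = 0" using ev by simp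
  have qL: "q j \<in> ?L" for j
    unfolding q_def mon_def using co adjoin_base[of F S] adjoin_generators[of S F]
    by (intro subfield_closed[OF L]) auto
  \<comment> \<open>\<open>Q\<close> vanishes at \<open>g\<close>, which is not algebraic over
    \<open>adjoin F S\<close>; so every \<open>q j\<close> must be zero.\<close>
  define Q where "Q = (\<Sum>j\<le>N. monom (q j) j)"
  have coQ: "coeff Q j = (if j \<le> N then q j else 0)" for j
    by (simp add: Q_def coeff_sum)
  have "Q \<in> polys_over ?L" using qL subfield_0[OF L] by (simp add: polys_over_def coQ)
  moreover have "poly Q g = 0" using rel by (simp add: Q_def poly_sum poly_monom)
  ultimately have "Q = 0" using g unfolding algebraic_over_def by blast
  then have q0: "q j = 0" if "j \<le> N" for j using coQ[of j] that by simp
  define j where "j = ?e \<mu>0"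
  \<comment> \<open>The formal counterpart of \<open>q j\<close>: the terms of \<open>P\<close> of
    degree \<open>j\<close> in \<open>g\<close>, with that power of \<open>g\<close> removed. Taking
    \<open>j\<close> from the monomial \<open>\<mu>0\<close> of \<open>P\<close> makes
    \<open>R\<close> nonzero.\<close>
  define R where "R = (\<Sum>\<mu>\<in>K j. Poly_Mapping.single (\<mu> - Poly_Mapping.single g j) (Poly_Mapping.lookup P \<mu>))"
  let ?r = "\<lambda>\<mu>. \<mu> - Poly_Mapping.single g j"
  have fK: "finite (K j)" by (simp add: K_def)
  have shift: "?r \<mu> + Poly_Mapping.single g j = \<mu>" if "\<mu> \<in> K j" for \<mu>
    using that by (intro poly_mapping_eqI) (auto simp: K_def lookup_add lookup_minus lookup_single when_def)
  have inj: "inj_on ?r (K j)" by (rule inj_onI) (metis shift)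
  have lkR: "Poly_Mapping.lookup R \<nu> = (\<Sum>\<mu>\<in>K j. if ?r \<mu> = \<nu> then Poly_Mapping.lookup P \<mu> else 0)" for \<nu>
    unfolding R_def by (simp add: lookup_sum lookup_single when_def)
  have lkR1: "Poly_Mapping.lookup R (?r \<mu>) = Poly_Mapping.lookup P \<mu>" if "\<mu> \<in> K j" for \<mu>
  proof -
    have "(\<Sum>\<mu>'\<in>K j. if ?r \<mu>' = ?r \<mu> then Poly_Mapping.lookup P \<mu>' else 0) =
      (\<Sum>\<mu>'\<in>K j. if \<mu>' = \<mu> then Poly_Mapping.lookup P \<mu> else 0)"
      using inj that by (intro sum.cong) (auto dest: inj_onD)
    then show ?thesis using that fK by (simp add: lkR)
  qed
  have keysR: "Poly_Mapping.keys R = ?r ` K j"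
  proof
    show "Poly_Mapping.keys R \<subseteq> ?r ` K j"
    proof
      fix \<nu> assume "\<nu> \<in> Poly_Mapping.keys R"
      then have "(\<Sum>\<mu>\<in>K j. if ?r \<mu> = \<nu> then Poly_Mapping.lookup P \<mu> else 0) \<noteq> 0"
        by (simp add: in_keys_iff lkR)
      moreover have "(\<Sum>\<mu>\<in>K j. if ?r \<mu> = \<nu> then Poly_Mapping.lookup P \<mu> else 0) = 0"
        if "\<nu> \<notin> ?r ` K j"
        using that by (intro sum.neutral) auto
      ultimately show "\<nu> \<in> ?r ` K j" by blast
    qed
    show "?r ` K j \<subseteq> Poly_Mapping.keys R"
      by (auto simp: in_keys_iff lkR1) (simp add: K_def in_keys_iff)
  qed
  have sub: "Poly_Mapping.keys (?r \<mu>) \<subseteq> S" if "\<mu> \<in> K j" for \<mu>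
  proof
    fix s assume s: "s \<in> Poly_Mapping.keys (?r \<mu>)"
    then have "s \<noteq> g" using that by (auto simp: in_keys_iff lookup_minus lookup_single K_def)
    moreover have "s \<in> Poly_Mapping.keys \<mu>"
      using s by (auto simp: in_keys_iff lookup_minus)
    ultimately show "s \<in> S" using that keys by (auto simp: K_def)
  qed
  have monr: "(\<Prod>s\<in>Poly_Mapping.keys (?r \<mu>). s ^ Poly_Mapping.lookup (?r \<mu>) s) = mon \<mu>" if "\<mu> \<in> K j" for \<mu>
  proof -
    have "(\<Prod>s\<in>Poly_Mapping.keys (?r \<mu>). s ^ Poly_Mapping.lookup (?r \<mu>) s) = (\<Prod>s\<in>S. s ^ Poly_Mapping.lookup (?r \<mu>) s)"
      using sub[OF that] S(2) by (intro prod.mono_neutral_left) (auto simp: in_keys_iff)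
    also have "\<dots> = mon \<mu>"
      unfolding mon_def using \<open>g \<notin> S\<close> by (intro prod.cong) (auto simp: lookup_minus lookup_single when_def)
    finally show ?thesis .
  qed
  have "eval_at_names R = q j"
    unfolding eval_at_names_def keysR q_def
    by (subst sum.reindex[OF inj]) (intro sum.cong, auto simp: lkR1 monr)
  also have "\<dots> = 0" using q0 eN[OF \<mu>0] by (simp add: j_def)
  finally have "eval_at_names R = 0" .
  moreover have "\<forall>\<nu>. Poly_Mapping.lookup R \<nu> \<in> F"
    using co subfield_0[OF F] by (auto simp: lkR intro!: subfield_sum[OF F])
  moreover have "\<forall>\<nu>\<in>Poly_Mapping.keys R. Poly_Mapping.keys \<nu> \<subseteq> S" using sub by (auto simp: keysR)
  ultimately have "R = 0" using S(1) unfolding alg_indep_over_def by blast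
  moreover have "\<mu>0 \<in> K j" using \<mu>0 by (simp add: K_def j_def)
  ultimately show False using lkR1[of \<mu>0] \<mu>0 by (simp add: in_keys_iff)
qed

text \<open>Greedy choice of a transcendence basis: an element joins \<open>S\<close> exactly when
  it is not algebraic over what has been adjoined so far.\<close>

lemma alg_indep_subset_exists:
  assumes F: "is_subfield F" and "finite G"
  shows "\<exists>S\<subseteq>G. alg_indep_over F S \<and> (\<forall>g\<in>G. algebraic_over (adjoin F S) g)"
  using assms(2)
proof (induction G rule: finite_induct)
  case empty
  then show ?case using alg_indep_over_empty by blast
next
  case (insert g G)
  then obtain S where S: "S \<subseteq> G" "alg_indep_over F S" "\<forall>h\<in>G. algebraic_over (adjoin F S) h" by blast
  show ?case
  proof (cases "algebraic_over (adjoin F S) g")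
    case True
    then show ?thesis using S by blast
  next
    case False
    let ?L = "adjoin F (insert g S)"
    have "finite S" using S insert finite_subset by blast
    then have "alg_indep_over F (insert g S)" using alg_indep_over_insert[OF F S(2) _ False] by blast
    moreover have "adjoin F S \<subseteq> ?L"
      using adjoin_base adjoin_generators by (intro adjoin_least subfield_adjoin) blast+
    then have "\<forall>h\<in>G. algebraic_over ?L h" using S(3) algebraic_over_mono by blast
    moreover have "algebraic_over ?L g"
    proof -
      have "g \<in> ?L" using adjoin_generators by blast
      then have "[:-g, 1:] \<in> polys_over ?L"
        using subfield_adjoin[of F "insert g S"] by (intro polys_over_closed subfield_closed)
      then show ?thesis unfolding algebraic_over_def by (intro bexI) auto
    qed
    ultimately show ?thesis using S(1) by (intro exI[of _ "insert g S"]) auto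
  qed
qed

section \<open>Derivations and transcendence bases\<close>

lemma derivation_kernel_subfield:
  fixes d :: "'a::field \<Rightarrow> 'a"
  assumes d: "derivation_on UNIV d"
  shows "is_subfield {x. d x = 0}"
proof -
  note U = subfield_UNIV d
  have "d (inverse x) = 0" if "d x = 0" for x
    using derivation_inverse[OF U, of x] that derivation_0[OF U] by (cases "x = 0") auto
  then show ?thesis
    by (simp add: is_subfield_def derivation_0[OF U] derivation_1[OF U] derivation_add[OF U]
        derivation_mult[OF U] derivation_uminus[OF U])
qed

text \<open>The kernel of \<open>d\<close> is a subfield, so it contains \<open>adjoin F S\<close>,
  and derivations vanish on what is algebraic over their kernel. Vanishing thus has to be arranged
  only on \<open>S\<close>.\<close>

lemma derivation_eq_0_of_transcendence_basis:
  fixes d :: "'a::field_char_0 \<Rightarrow> 'a"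
  assumes d: "derivation_on UNIV d" and "\<forall>x\<in>F. d x = 0" "\<forall>x\<in>S. d x = 0"
    and g: "algebraic_over (adjoin F S) g"
  shows "d g = 0"
proof -
  have "adjoin F S \<subseteq> {x. d x = 0}"
    using assms by (intro adjoin_least derivation_kernel_subfield) auto
  then show ?thesis by (intro derivation_algebraic_eq_0[OF subfield_adjoin d _ g]) auto
qed


subsection \<open>The trace of a simple extension and the logarithmic derivative of the norm\<close>

definition mat_trace :: "'a::comm_ring_1 mat \<Rightarrow> 'a" where
  "mat_trace A = (\<Sum>i<dim_row A. A $$ (i, i))"

lemma mat_trace_add:
  "A \<in> carrier_mat n n \<Longrightarrow> B \<in> carrier_mat n n \<Longrightarrow> mat_trace (A + B) = mat_trace A + mat_trace B"
  by (simp add: mat_trace_def sum.distrib)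

lemma mat_trace_minus:
  "A \<in> carrier_mat n n \<Longrightarrow> B \<in> carrier_mat n n \<Longrightarrow> mat_trace (A - B) = mat_trace A - mat_trace B"
  by (simp add: mat_trace_def sum_subtractf)

lemma mat_trace_mult_commute:
  assumes "A \<in> carrier_mat n n" "B \<in> carrier_mat n n"
  shows "mat_trace (A * B) = mat_trace (B * A)"
proof -
  have "mat_trace (A * B) = (\<Sum>i<n. \<Sum>k<n. A $$ (i, k) * B $$ (k, i))"
    using assms by (simp add: mat_trace_def scalar_prod_def atLeast0LessThan)
  also have "\<dots> = (\<Sum>k<n. \<Sum>i<n. B $$ (k, i) * A $$ (i, k))"
    by (subst sum.swap) (simp add: mult.commute)
  also have "\<dots> = mat_trace (B * A)"
    using assms by (simp add: mat_trace_def scalar_prod_def atLeast0LessThan)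
  finally show ?thesis .
qed

text \<open>Jacobi's formula. By the Leibniz rule the derivative is the sum of the determinants of
  the \<open>R i\<close>, where row \<open>i\<close> of \<open>A\<close> is differentiated;
  expanding along that row uses the cofactors of \<open>A\<close>.\<close>

lemma derivation_det:
  fixes d :: "'a::field \<Rightarrow> 'a"
  assumes d: "derivation_on UNIV d" and A: "A \<in> carrier_mat n n"
  shows "d (det A) = mat_trace (map_mat d A * adj_mat A)"
proof -
  note U = subfield_UNIV d
  let ?P = "{p. p permutes {0..<n}}"
  define R where "R i = mat n n (\<lambda>(k, j). if k = i then d (A $$ (i, j)) else A $$ (k, j))" for i
  have R: "R i \<in> carrier_mat n n" for i by (simp add: R_def)
  have sgn: "d (signof p * x) = signof p * d x" for p x
    by (simp add: sign_def derivation_uminus[OF U])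
  have product: "d (\<Prod>i=0..<n. A $$ (i, p i)) = (\<Sum>i=0..<n. \<Prod>k=0..<n. R i $$ (k, p k))" if p: "p permutes {0..<n}" for p
  proof -
    have pn: "p i < n" if "i < n" for i using p that permutes_in_image[OF p, of i] by simp
    have "d (A $$ (i, p i)) * (\<Prod>k\<in>{0..<n} - {i}. A $$ (k, p k)) = (\<Prod>k=0..<n. R i $$ (k, p k))"
      if i: "i \<in> {0..<n}" for i
    proof -
      have "(\<Prod>k\<in>{0..<n} - {i}. A $$ (k, p k)) = (\<Prod>k\<in>{0..<n} - {i}. R i $$ (k, p k))"
        using pn by (intro prod.cong) (auto simp: R_def)
      moreover have "d (A $$ (i, p i)) = R i $$ (i, p i)" using i pn by (auto simp: R_def)
      ultimately show ?thesis using i by (simp add: prod.remove)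
    qed
    then show ?thesis by (simp add: derivation_prod[OF U])
  qed
  have "d (det A) = (\<Sum>p\<in>?P. signof p * (\<Sum>i=0..<n. \<Prod>k=0..<n. R i $$ (k, p k)))"
    unfolding det_def'[OF A] by (simp add: derivation_sum[OF U] sgn product)
  also have "\<dots> = (\<Sum>i=0..<n. det (R i))"
    unfolding det_def'[OF R] sum_distrib_left by (rule sum.swap)
  also have "\<dots> = (\<Sum>i<n. \<Sum>j<n. d (A $$ (i, j)) * cofactor A i j)"
    unfolding atLeast0LessThan
  proof (intro sum.cong refl)
    fix i assume i: "i \<in> {..<n}"
    have "cofactor (R i) i j = cofactor A i j" for j
    proof -
      have "mat_delete (R i) i j = mat_delete A i j"
        using A by (intro eq_matI) (auto simp: mat_delete_def R_def)
      then show ?thesis by (simp add: cofactor_def)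
    qed
    then show "det (R i) = (\<Sum>j<n. d (A $$ (i, j)) * cofactor A i j)"
      using laplace_expansion_row[OF R, of i i] i by (simp add: R_def)
  qed
  also have "\<dots> = mat_trace (map_mat d A * adj_mat A)"
    using A adj_mat(1)[OF A] by (simp add: mat_trace_def scalar_prod_def atLeast0LessThan adj_mat_def)
  finally show ?thesis .
qed

text \<open>A finite extension \<open>L\<close> of \<open>E\<close>, both stable under
  \<open>\<theta>\<close>, with basis \<open>b 0\<close>, ..., \<open>b (r - 1)\<close> and
  coordinate functions \<open>co\<close>: the data for computing trace and norm by matrices over
  \<open>E\<close>.\<close>

locale differential_basis =
  fixes E L :: "'a::field_char_0 set" and \<theta> :: "'a \<Rightarrow> 'a" and r :: nat and b :: "nat \<Rightarrow> 'a"
    and co :: "'a \<Rightarrow> nat \<Rightarrow> 'a"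
  assumes E: "is_subfield E" and L: "is_subfield L" and EL: "E \<subseteq> L"
    and \<theta>: "derivation_on UNIV \<theta>" and \<theta>E: "x \<in> E \<Longrightarrow> \<theta> x \<in> E" and \<theta>L: "x \<in> L \<Longrightarrow> \<theta> x \<in> L"
    and b: "b i \<in> L"
    and co: "x \<in> L \<Longrightarrow> co x j \<in> E" and expand: "x \<in> L \<Longrightarrow> x = (\<Sum>j<r. co x j * b j)"
    and indep: "(\<And>j. j < r \<Longrightarrow> e j \<in> E) \<Longrightarrow> (\<Sum>j<r. e j * b j) = 0 \<Longrightarrow> j < r \<Longrightarrow> e j = 0"
begin

lemma co_eqI:
  assumes "x \<in> L" "\<And>j. j < r \<Longrightarrow> e j \<in> E" "x = (\<Sum>j<r. e j * b j)" "j < r"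
  shows "co x j = e j"
proof -
  have "(\<Sum>j<r. (co x j - e j) * b j) = 0"
    using expand[OF assms(1)] assms(3) by (simp add: left_diff_distrib sum_subtractf)
  then have "co x j - e j = 0"
    by (rule indep[rotated]) (use assms co E in \<open>auto intro: subfield_diff\<close>)
  then show ?thesis by simp
qed

definition mult_mat :: "'a \<Rightarrow> 'a mat" where
  "mult_mat x = mat r r (\<lambda>(i, j). co (b i * x) j)"

text \<open>The connection matrix: it measures how far \<open>\<theta>\<close> is from acting
  coordinatewise.\<close>

definition conn_mat :: "'a mat" where
  "conn_mat = mat r r (\<lambda>(i, j). co (\<theta> (b i)) j)"

lemma carrier [simp]: "mult_mat x \<in> carrier_mat r r" "conn_mat \<in> carrier_mat r r"
  by (simp_all add: mult_mat_def conn_mat_def)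

lemmas mult_carrier [simp] = mult_carrier_mat[of _ r r _ r]

lemma dims [simp]: "dim_row (mult_mat x) = r" "dim_col (mult_mat x) = r"
  "dim_row conn_mat = r" "dim_col conn_mat = r"
  by (simp_all add: mult_mat_def conn_mat_def)

lemma mult_mat_expand: "x \<in> L \<Longrightarrow> i < r \<Longrightarrow> b i * x = (\<Sum>j<r. mult_mat x $$ (i, j) * b j)"
  using expand[of "b i * x"] by (simp add: mult_mat_def subfield_mult[OF L b])

lemma conn_mat_expand: "i < r \<Longrightarrow> \<theta> (b i) = (\<Sum>j<r. conn_mat $$ (i, j) * b j)"
  using expand[of "\<theta> (b i)"] by (simp add: conn_mat_def \<theta>L b)

lemma mult_mat_in: "x \<in> L \<Longrightarrow> i < r \<Longrightarrow> j < r \<Longrightarrow> mult_mat x $$ (i, j) \<in> E"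
  by (simp add: mult_mat_def co subfield_mult[OF L b])

lemma conn_mat_in: "i < r \<Longrightarrow> j < r \<Longrightarrow> conn_mat $$ (i, j) \<in> E"
  by (simp add: conn_mat_def co \<theta>L b)

lemma mult_mat_eqI:
  assumes x: "x \<in> L" and A: "A \<in> carrier_mat r r" "\<And>i j. i < r \<Longrightarrow> j < r \<Longrightarrow> A $$ (i, j) \<in> E"
    and eq: "\<And>i. i < r \<Longrightarrow> b i * x = (\<Sum>j<r. A $$ (i, j) * b j)"
  shows "mult_mat x = A"
proof (rule eq_matI)
  fix i j assume "i < dim_row A" "j < dim_col A"
  then have ij: "i < r" "j < r" using A(1) by auto
  have "co (b i * x) j = A $$ (i, j)"
    by (rule co_eqI[OF subfield_mult[OF L b x] A(2)[OF ij(1)] eq[OF ij(1)] ij(2)])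
  then show "mult_mat x $$ (i, j) = A $$ (i, j)" using ij by (simp add: mult_mat_def)
qed (use A in \<open>auto simp: mult_mat_def\<close>)

lemma mult_mat_add:
  assumes "x \<in> L" "y \<in> L"
  shows "mult_mat (x + y) = mult_mat x + mult_mat y"
  using assms
  by (intro mult_mat_eqI)
    (auto simp: subfield_add[OF L] subfield_add[OF E] mult_mat_in distrib_left distrib_right
      mult_mat_expand sum.distrib)

lemma mult_mat_base:
  assumes "e \<in> E" shows "mult_mat e = e \<cdot>\<^sub>m 1\<^sub>m r"
proof (rule mult_mat_eqI)
  fix i assume i: "i < r"
  have "(\<Sum>j<r. (e \<cdot>\<^sub>m 1\<^sub>m r) $$ (i, j) * b j) = (\<Sum>j<r. if j = i then e * b i else 0)"
    using i by (intro sum.cong) auto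
  then show "b i * e = (\<Sum>j<r. (e \<cdot>\<^sub>m 1\<^sub>m r) $$ (i, j) * b j)" using i by simp
qed (use assms EL subfield_0[OF E] in auto)

lemma mult_mat_mult:
  assumes x: "x \<in> L" and y: "y \<in> L"
  shows "mult_mat (x * y) = mult_mat x * mult_mat y"
proof (rule mult_mat_eqI)
  show "x * y \<in> L" by (rule subfield_mult[OF L x y])
  have entry: "(mult_mat x * mult_mat y) $$ (i, j) = (\<Sum>k<r. mult_mat x $$ (i, k) * mult_mat y $$ (k, j))"
    if "i < r" "j < r" for i j
    using that by (simp add: scalar_prod_def atLeast0LessThan)
  show "(mult_mat x * mult_mat y) $$ (i, j) \<in> E" if "i < r" "j < r" for i j
    using that x y by (simp only: entry) (auto intro!: subfield_closed[OF E] mult_mat_in)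
  fix i assume i: "i < r"
  have "b i * (x * y) = (\<Sum>k<r. mult_mat x $$ (i, k) * (b k * y))"
    using mult_mat_expand[OF x i] by (simp add: mult.assoc[symmetric] sum_distrib_right)
  also have "\<dots> = (\<Sum>k<r. \<Sum>j<r. mult_mat x $$ (i, k) * mult_mat y $$ (k, j) * b j)"
    by (intro sum.cong refl) (simp add: mult_mat_expand[OF y] sum_distrib_left mult.assoc)
  also have "\<dots> = (\<Sum>j<r. (mult_mat x * mult_mat y) $$ (i, j) * b j)"
    using i by (subst sum.swap) (simp add: entry sum_distrib_right del: index_mult_mat)
  finally show "b i * (x * y) = (\<Sum>j<r. (mult_mat x * mult_mat y) $$ (i, j) * b j)" .
qed simp

text \<open>Compute \<open>\<theta> (b i * x)\<close> by the Leibniz rule and from the expansion in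
  the basis, then compare coordinates. The correction to entrywise differentiation is a
  commutator.\<close>

lemma mult_mat_derivation:
  assumes x: "x \<in> L"
  shows "mult_mat (\<theta> x) = map_mat \<theta> (mult_mat x) + mult_mat x * conn_mat - conn_mat * mult_mat x"
    (is "_ = ?A")
proof (rule mult_mat_eqI)
  note U = subfield_UNIV \<theta>
  show "\<theta> x \<in> L" by (rule \<theta>L[OF x])
  have entry: "?A $$ (i, j) = \<theta> (mult_mat x $$ (i, j)) + (\<Sum>k<r. mult_mat x $$ (i, k) * conn_mat $$ (k, j))
      - (\<Sum>k<r. conn_mat $$ (i, k) * mult_mat x $$ (k, j))" if "i < r" "j < r" for i j
    using that by (simp add: scalar_prod_def atLeast0LessThan)
  show "?A $$ (i, j) \<in> E" if "i < r" "j < r" for i j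
    using that x by (simp only: entry) (auto intro!: subfield_closed[OF E] mult_mat_in conn_mat_in \<theta>E)
  show "?A \<in> carrier_mat r r" by (rule carrier_matI) simp_all
  fix i assume i: "i < r"
  have "\<theta> (b i * x) = (\<Sum>j<r. \<theta> (mult_mat x $$ (i, j)) * b j + mult_mat x $$ (i, j) * \<theta> (b j))"
    unfolding mult_mat_expand[OF x i] by (simp add: derivation_sum[OF U] derivation_mult[OF U])
  moreover have "(\<Sum>j<r. mult_mat x $$ (i, j) * \<theta> (b j)) =
      (\<Sum>k<r. \<Sum>j<r. mult_mat x $$ (i, j) * conn_mat $$ (j, k) * b k)"
    by (subst sum.swap, intro sum.cong refl) (simp add: conn_mat_expand sum_distrib_left mult.assoc)
  moreover have "\<theta> (b i) * x = (\<Sum>k<r. \<Sum>j<r. conn_mat $$ (i, j) * mult_mat x $$ (j, k) * b k)"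
  proof -
    have "\<theta> (b i) * x = (\<Sum>j<r. conn_mat $$ (i, j) * (b j * x))"
      by (simp add: conn_mat_expand[OF i] sum_distrib_right mult.assoc)
    also have "\<dots> = (\<Sum>k<r. \<Sum>j<r. conn_mat $$ (i, j) * mult_mat x $$ (j, k) * b k)"
      by (subst sum.swap, intro sum.cong refl) (simp add: mult_mat_expand[OF x] sum_distrib_left mult.assoc)
    finally show ?thesis .
  qed
  moreover have "\<theta> (b i * x) = \<theta> (b i) * x + b i * \<theta> x" by (simp add: derivation_mult[OF U])
  ultimately have "b i * \<theta> x = (\<Sum>j<r. \<theta> (mult_mat x $$ (i, j)) * b j)
      + (\<Sum>k<r. \<Sum>j<r. mult_mat x $$ (i, j) * conn_mat $$ (j, k) * b k)
      - (\<Sum>k<r. \<Sum>j<r. conn_mat $$ (i, j) * mult_mat x $$ (j, k) * b k)"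
    by (simp add: sum.distrib eq_diff_eq add.commute)
  also have "\<dots> = (\<Sum>j<r. ?A $$ (i, j) * b j)"
    unfolding sum.distrib[symmetric] sum_subtractf[symmetric]
    by (intro sum.cong refl)
      (simp only: lessThan_iff entry[OF i] sum_distrib_right left_diff_distrib distrib_right)
  finally show "b i * \<theta> x = (\<Sum>j<r. ?A $$ (i, j) * b j)" .
qed

definition tr :: "'a \<Rightarrow> 'a" where "tr x = mat_trace (mult_mat x)"

definition norm_ext :: "'a \<Rightarrow> 'a" where "norm_ext x = det (mult_mat x)"

lemma tr_in: "x \<in> L \<Longrightarrow> tr x \<in> E"
  by (auto simp: tr_def mat_trace_def intro!: subfield_sum[OF E] mult_mat_in)

lemma norm_ext_in: "x \<in> L \<Longrightarrow> norm_ext x \<in> E"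
proof -
  assume x: "x \<in> L"
  have "signof p \<in> E" for p :: "nat \<Rightarrow> nat"
    by (auto simp: sign_def intro: subfield_closed[OF E])
  moreover have "mult_mat x $$ (i, p i) \<in> E" if "p permutes {0..<r}" "i < r" for p i
    using mult_mat_in[OF x that(2), of "p i"] permutes_in_image[OF that(1), of i] that(2) by simp
  ultimately show ?thesis
    unfolding norm_ext_def det_def'[OF carrier(1)] by (auto intro!: subfield_closed[OF E])
qed

lemma tr_add: "x \<in> L \<Longrightarrow> y \<in> L \<Longrightarrow> tr (x + y) = tr x + tr y"
  by (simp add: tr_def mult_mat_add mat_trace_add[OF carrier(1) carrier(1)])

lemma tr_scale: 
  assumes "e \<in> E" "x \<in> L" shows "tr (e * x) = e * tr x"
proof -
  have "mult_mat (e * x) = e \<cdot>\<^sub>m mult_mat x"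
    using assms EL by (simp add: mult_mat_mult mult_mat_base subsetD mult_smult_assoc_mat[of _ r r _ r])
  then show ?thesis by (simp add: tr_def mat_trace_def sum_distrib_left)
qed

lemma tr_1: "tr 1 = of_nat r"
  by (simp add: tr_def mult_mat_base[OF subfield_1[OF E]] mat_trace_def)

text \<open>The commutator with the connection matrix has trace zero.\<close>

lemma tr_derivation:
  assumes x: "x \<in> L" shows "tr (\<theta> x) = \<theta> (tr x)"
proof -
  have "tr (\<theta> x) = mat_trace (map_mat \<theta> (mult_mat x)) + mat_trace (mult_mat x * conn_mat)
      - mat_trace (conn_mat * mult_mat x)"
    unfolding tr_def mult_mat_derivation[OF x] by (simp add: mat_trace_minus[of _ r] mat_trace_add[of _ r])
  also have "\<dots> = mat_trace (map_mat \<theta> (mult_mat x))"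
    by (simp add: mat_trace_mult_commute[of _ r])
  also have "\<dots> = \<theta> (tr x)"
    by (simp add: tr_def mat_trace_def derivation_sum[OF subfield_UNIV \<theta>])
  finally show ?thesis .
qed

text \<open>\<open>M\<close> is invertible with inverse \<open>N\<close>, so its adjugate is
  \<open>det M\<close> times \<open>N\<close>, and Jacobi's formula gives the logarithmic derivative
  of the norm as the trace of \<open>map_mat \<theta> M * N\<close>. In the trace of
  \<open>\<theta> f / f\<close> the two connection terms cancel by cyclicity.\<close>

lemma tr_log_derivation:
  assumes f: "f \<in> L" "f \<noteq> 0"
  shows "norm_ext f \<noteq> 0" "tr (\<theta> f / f) = \<theta> (norm_ext f) / norm_ext f"
proof -
  define M N where "M = mult_mat f" and "N = mult_mat (inverse f)"
  have cM: "M \<in> carrier_mat r r" "N \<in> carrier_mat r r" by (simp_all add: M_def N_def)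
  have fi: "inverse f \<in> L" by (rule subfield_inverse[OF L f(1)])
  have one: "mult_mat 1 = 1\<^sub>m r"
    using mult_mat_base[OF subfield_1[OF E]] by (auto intro!: eq_matI)
  have MN: "M * N = 1\<^sub>m r" "N * M = 1\<^sub>m r"
    using mult_mat_mult[OF f(1) fi] mult_mat_mult[OF fi f(1)] f one
    by (simp_all add: M_def N_def)
  have "det M * det N = 1" using det_mult[OF cM] MN by simp
  then have det0: "det M \<noteq> 0" by auto
  then show "norm_ext f \<noteq> 0" by (simp add: norm_ext_def M_def)
  have "adj_mat M = adj_mat M * (M * N)" using adj_mat(1)[OF cM(1)] MN by simp
  also have "\<dots> = det M \<cdot>\<^sub>m N"
    using adj_mat[OF cM(1)] cM by (simp add: assoc_mult_mat[symmetric, of _ r r _ r _ r] mult_smult_assoc_mat[of _ r r _ r])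
  finally have adj: "adj_mat M = det M \<cdot>\<^sub>m N" .
  have cD: "map_mat \<theta> M \<in> carrier_mat r r" using cM by simp
  have "\<theta> (det M) = det M * mat_trace (map_mat \<theta> M * N)"
    unfolding derivation_det[OF \<theta> cM(1)] adj
    using cM cD by (simp add: mult_smult_distrib[OF cD cM(2)] mat_trace_def sum_distrib_left)
  moreover have "tr (\<theta> f / f) = mat_trace (map_mat \<theta> M * N)"
  proof -
    have "tr (\<theta> f / f) = mat_trace ((map_mat \<theta> M + M * conn_mat - conn_mat * M) * N)"
      using mult_mat_mult[OF \<theta>L[OF f(1)] fi] mult_mat_derivation[OF f(1)]
      by (simp add: tr_def divide_inverse M_def N_def)
    also have "(map_mat \<theta> M + M * conn_mat - conn_mat * M) * N =
        map_mat \<theta> M * N + M * conn_mat * N - conn_mat * M * N"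
      using cM by (simp add: minus_mult_distrib_mat[of _ r r] add_mult_distrib_mat[of _ r r])
    also have "mat_trace \<dots> = mat_trace (map_mat \<theta> M * N) + mat_trace (M * conn_mat * N) - mat_trace (conn_mat * M * N)"
      using cM by (simp add: mat_trace_minus[of _ r] mat_trace_add[of _ r])
    also have "mat_trace (M * conn_mat * N) = mat_trace (N * (M * conn_mat))"
      using cM by (intro mat_trace_mult_commute) auto
    also have "N * (M * conn_mat) = conn_mat"
      using cM MN by (simp add: assoc_mult_mat[symmetric, of _ r r _ r _ r])
    also have "conn_mat * M * N = conn_mat"
      using cM MN by (simp add: assoc_mult_mat[of _ r r _ r _ r])
    finally show ?thesis by simp
  qed
  ultimately show "tr (\<theta> f / f) = \<theta> (norm_ext f) / norm_ext f"
    using det0 by (simp add: norm_ext_def M_def)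
qed

end


subsection \<open>Residue functionals\<close>

text \<open>The algebraic properties of a residue at a point. Only
  \<open>\<rho> 1 \<noteq> 0\<close> is demanded instead of \<open>\<rho> 1 = 1\<close>, since
  composing with a trace multiplies this value by the degree.\<close>

definition log_residue :: "('a::field_char_0 \<Rightarrow> 'a) \<Rightarrow> 'a set \<Rightarrow> 'a set \<Rightarrow> ('a \<Rightarrow> 'a) \<Rightarrow> bool" where
  "log_residue \<theta> F E \<rho> \<longleftrightarrow> is_subfield E \<and> F \<subseteq> E \<and> (\<forall>x\<in>E. \<theta> x \<in> E) \<and>
     (\<forall>x\<in>E. \<forall>y\<in>E. \<rho> (x + y) = \<rho> x + \<rho> y) \<and> (\<forall>c\<in>F. \<forall>x\<in>E. \<rho> (c * x) = c * \<rho> x) \<and>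
     (\<forall>v\<in>E. \<rho> (\<theta> v) = 0) \<and> (\<forall>f\<in>E - {0}. \<rho> (\<theta> f / f) \<in> \<int>) \<and> \<rho> 1 \<noteq> 0"

lemma log_residue_mono: "log_residue \<theta> F E \<rho> \<Longrightarrow> C \<subseteq> F \<Longrightarrow> log_residue \<theta> C E \<rho>"
  unfolding log_residue_def by blast

text \<open>Powers of \<open>a\<close> below the degree of the minimal polynomial form the basis;
  the coordinates are the coefficients of remainders modulo \<open>P\<close>.\<close>

lemma differential_basis_simple_ext:
  fixes a :: "'a::field_char_0"
  assumes E: "is_subfield E" and \<theta>: "derivation_on UNIV \<theta>" and st: "\<forall>x\<in>E. \<theta> x \<in> E"
    and a: "algebraic_over E a"
  shows "\<exists>r co. r > 0 \<and> differential_basis E (simple_ext E a) \<theta> r (\<lambda>i. a ^ i) co"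
proof -
  obtain P where P: "minimal_poly E a P" using minimal_poly_exists[OF a] by blast
  let ?r = "degree P" and ?L = "simple_ext E a"
  note L = subfield_simple_ext[OF E a]
  have "\<exists>p. p \<in> polys_over E \<and> x = poly p a \<and> (p = 0 \<or> degree p < ?r)" if x: "x \<in> ?L" for x
  proof -
    obtain p where p: "p \<in> polys_over E" "x = poly p a" using x by (rule simple_extE)
    obtain q r where qr: "r \<in> polys_over E" "p = P * q + r" "r = 0 \<or> degree r < degree P"
      using polys_over_division[OF E _ _ p(1), of P] P by (auto simp: minimal_poly_def)
    then have "x = poly r a" using p P by (simp add: minimal_poly_def)
    then show ?thesis using qr by blast
  qed
  then obtain rem where rem: "\<And>x. x \<in> ?L \<Longrightarrow> rem x \<in> polys_over E"
    "\<And>x. x \<in> ?L \<Longrightarrow> x = poly (rem x) a" "\<And>x. x \<in> ?L \<Longrightarrow> rem x = 0 \<or> degree (rem x) < ?r"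
    by metis
  have "differential_basis E ?L \<theta> ?r (\<lambda>i. a ^ i) (\<lambda>x. coeff (rem x))"
  proof
    show "is_subfield E" "is_subfield ?L" "derivation_on UNIV \<theta>" by fact+
    show "E \<subseteq> ?L" by (rule simple_ext_base[OF E])
    show "\<theta> x \<in> E" if "x \<in> E" for x using st that by blast
    show "\<theta> x \<in> ?L" if "x \<in> ?L" for x by (rule derivation_stable_simple_ext[OF E \<theta> st a that])
    show "a ^ i \<in> ?L" for i by (rule subfield_power[OF L simple_ext_generator[OF E]])
    show "coeff (rem x) j \<in> E" if "x \<in> ?L" for x j by (rule polys_over_coeff[OF rem(1)[OF that]])
    show "x = (\<Sum>j<?r. coeff (rem x) j * a ^ j)" if x: "x \<in> ?L" for x
    proof -
      have "poly (rem x) a = (\<Sum>j<?r. coeff (rem x) j * a ^ j)"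
      proof (cases "rem x = 0")
        case False
        then have "degree (rem x) < ?r" using rem(3)[OF x] by simp
        then show ?thesis
          unfolding poly_altdef by (intro sum.mono_neutral_left) (auto simp: coeff_eq_0)
      qed simp
      then show ?thesis using rem(2)[OF x] by simp
    qed
    show "e j = 0" if e: "\<And>j. j < ?r \<Longrightarrow> e j \<in> E" "(\<Sum>j<?r. e j * a ^ j) = 0" "j < ?r" for e j
    proof -
      define Q where "Q = (\<Sum>j<?r. monom (e j) j)"
      have co: "coeff Q k = (if k < ?r then e k else 0)" for k
        by (simp add: Q_def coeff_sum)
      have "Q \<in> polys_over E" using e(1) subfield_0[OF E] by (simp add: polys_over_def co)
      moreover have "poly Q a = 0" using e(2) by (simp add: Q_def poly_sum poly_monom)
      moreover have "degree Q < ?r" if "Q \<noteq> 0"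
        using co[of "degree Q"] that by (auto split: if_splits)
      ultimately have "Q = 0" using P unfolding minimal_poly_def by (meson not_less)
      then show ?thesis using co[of j] e(3) by simp
    qed
  qed
  then show ?thesis using minimal_poly_degree[OF P] by blast
qed

text \<open>Compose \<open>\<rho>\<close> with the trace: derivatives go to derivatives, logarithmic
  derivatives to those of norms, and \<open>tr 1\<close> is the degree, nonzero in characteristic
  0.\<close>

lemma log_residue_simple_ext:
  assumes \<theta>: "derivation_on UNIV \<theta>" and \<rho>: "log_residue \<theta> F E \<rho>" and a: "algebraic_over E a"
  shows "\<exists>\<rho>'. log_residue \<theta> F (simple_ext E a) \<rho>'"
proof -
  have E: "is_subfield E" and FE: "F \<subseteq> E" and st: "\<forall>x\<in>E. \<theta> x \<in> E"
    and add: "\<And>x y. x \<in> E \<Longrightarrow> y \<in> E \<Longrightarrow> \<rho> (x + y) = \<rho> x + \<rho> y"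
    and scale: "\<And>c x. c \<in> F \<Longrightarrow> x \<in> E \<Longrightarrow> \<rho> (c * x) = c * \<rho> x"
    and exact: "\<And>v. v \<in> E \<Longrightarrow> \<rho> (\<theta> v) = 0"
    and log: "\<And>f. f \<in> E \<Longrightarrow> f \<noteq> 0 \<Longrightarrow> \<rho> (\<theta> f / f) \<in> \<int>" and one: "\<rho> 1 \<noteq> 0"
    using \<rho> by (auto simp: log_residue_def)
  obtain r co where r: "r > 0" and "differential_basis E (simple_ext E a) \<theta> r (\<lambda>i. a ^ i) co"
    using differential_basis_simple_ext[OF E \<theta> st a] by blast
  then interpret differential_basis E "simple_ext E a" \<theta> r "\<lambda>i. a ^ i" co by blast
  have "\<rho> 0 = 0" using add[of 0 0] subfield_0[OF E] by simp
  then have "\<rho> (of_nat k) = of_nat k * \<rho> 1" for k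
    by (induction k) (simp_all add: add subfield_of_nat[OF E] subfield_1[OF E] algebra_simps)
  then have "\<rho> (tr 1) \<noteq> 0" using one r by (simp add: tr_1)
  then have "log_residue \<theta> F (simple_ext E a) (\<lambda>x. \<rho> (tr x))"
    unfolding log_residue_def
    using L EL FE by (auto simp: tr_add add tr_in tr_scale subsetD[OF FE] scale tr_derivation exact \<theta>L
        tr_log_derivation norm_ext_in intro!: log)
  then show ?thesis by blast
qed

text \<open>The ambient field may have infinite degree over \<open>E\<close>, so the residue is
  carried up only to an extension containing the finite set \<open>A\<close>.\<close>

lemma log_residue_finite_ext:
  assumes \<theta>: "derivation_on UNIV \<theta>" and \<rho>: "log_residue \<theta> F E \<rho>"
    and "finite A" and alg: "\<And>a. a \<in> A \<Longrightarrow> algebraic_over E a"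
  shows "\<exists>E' \<rho>'. E \<subseteq> E' \<and> A \<subseteq> E' \<and> log_residue \<theta> F E' \<rho>'"
  using assms(3,4)
proof (induction A rule: finite_induct)
  case empty
  then show ?case using \<rho> by blast
next
  case (insert a A)
  then obtain E' \<rho>' where E': "E \<subseteq> E'" "A \<subseteq> E'" "log_residue \<theta> F E' \<rho>'" by blast
  then have "is_subfield E'" by (simp add: log_residue_def)
  moreover have "algebraic_over E' a" using insert.prems[of a] algebraic_over_mono E'(1) by blast
  ultimately show ?case
    using log_residue_simple_ext[OF \<theta> E'(3)] simple_ext_base[of E' a] simple_ext_generator[of E' a] E'
    by (intro exI[of _ "simple_ext E' a"]) blast
qed


subsection \<open>Rational function fields\<close>

definition rat_ext :: "'a::field set \<Rightarrow> 'a \<Rightarrow> 'a set" where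
  "rat_ext F x = {poly p x / poly q x | p q. p \<in> polys_over F \<and> q \<in> polys_over F \<and> poly q x \<noteq> 0}"

lemma rat_extI:
  "p \<in> polys_over F \<Longrightarrow> q \<in> polys_over F \<Longrightarrow> poly q x \<noteq> 0 \<Longrightarrow> poly p x / poly q x \<in> rat_ext F x"
  unfolding rat_ext_def by blast

lemma rat_ext_poly: "is_subfield F \<Longrightarrow> p \<in> polys_over F \<Longrightarrow> poly p x \<in> rat_ext F x"
  using rat_extI[of p F 1 x] by (simp add: polys_over_1)

lemma rat_ext_base: "is_subfield F \<Longrightarrow> F \<subseteq> rat_ext F x"
  using rat_ext_poly[of F "[:_:]" x] by (auto intro: polys_over_closed)

lemma rat_ext_generator: "is_subfield F \<Longrightarrow> x \<in> rat_ext F x"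
  using rat_ext_poly[of F "[:0, 1:]" x] by (simp add: polys_over_closed subfield_closed)

lemma subfield_rat_ext:
  assumes F: "is_subfield F"
  shows "is_subfield (rat_ext F x)"
proof -
  have "u + v \<in> rat_ext F x \<and> u * v \<in> rat_ext F x \<and> - u \<in> rat_ext F x \<and> inverse u \<in> rat_ext F x"
    if uv: "u \<in> rat_ext F x" "v \<in> rat_ext F x" for u v
  proof -
    obtain p q where pq: "p \<in> polys_over F" "q \<in> polys_over F" "poly q x \<noteq> 0" "u = poly p x / poly q x"
      using uv(1) unfolding rat_ext_def by blast
    obtain s t where st: "s \<in> polys_over F" "t \<in> polys_over F" "poly t x \<noteq> 0" "v = poly s x / poly t x"
      using uv(2) unfolding rat_ext_def by blast
    have "poly (p * t + s * q) x / poly (q * t) x \<in> rat_ext F x"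
      "poly (p * s) x / poly (q * t) x \<in> rat_ext F x"
      "poly (- p) x / poly q x \<in> rat_ext F x"
      by (intro rat_extI polys_over_closed F pq st; simp add: pq st)+
    moreover have "inverse u \<in> rat_ext F x"
    proof (cases "poly p x = 0")
      case True
      then show ?thesis using rat_ext_base[OF F, of x] subfield_0[OF F] pq by auto
    next
      case False
      then show ?thesis using rat_extI[OF pq(2,1) False] pq by simp
    qed
    ultimately show ?thesis using pq st by (simp add: add_frac_eq)
  qed
  then show ?thesis
    using rat_ext_base[OF F, of x] subfield_0[OF F] subfield_1[OF F]
    unfolding is_subfield_def by blast
qed

section \<open>Laurent expansions and the Euler operator\<close>

definition fls_of_poly :: "'a::field_char_0 poly \<Rightarrow> 'a fls" where
  "fls_of_poly p = fps_to_fls (fps_of_poly p)"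

lemma fls_of_poly_simps:
  "fls_of_poly (p + q) = fls_of_poly p + fls_of_poly q"
  "fls_of_poly (p - q) = fls_of_poly p - fls_of_poly q"
  "fls_of_poly (p * q) = fls_of_poly p * fls_of_poly q"
  "fls_of_poly 1 = 1" "fls_of_poly 0 = 0" "fls_of_poly [:c:] = fls_const c"
  "fls_of_poly (pCons 0 p) = fls_X * fls_of_poly p"
  "fls_of_poly (pderiv p) = fls_deriv (fls_of_poly p)"
  "fls_of_poly p = 0 \<longleftrightarrow> p = 0"
  by (simp_all add: fls_of_poly_def fps_of_poly_add fps_of_poly_diff fps_of_poly_mult 
      fls_times_fps_to_fls fps_of_poly_const fps_of_poly_pCons
      fps_of_poly_pderiv fls_deriv_fps_to_fls)

lemma fls_deriv_divide:
  fixes f g :: "'a::field_char_0 fls"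
  assumes "g \<noteq> 0"
  shows "fls_deriv (f / g) = (fls_deriv f * g - f * fls_deriv g) / g ^ 2"
proof -
  have "fls_deriv f = fls_deriv (f / g * g)" using assms by simp
  also have "\<dots> = f / g * fls_deriv g + fls_deriv (f / g) * g" by (rule fls_deriv_mult)
  finally show ?thesis using assms by (simp add: field_simps power2_eq_square)
qed

text \<open>For two representations \<open>n / e\<close> and \<open>p / q\<close> of one fraction,
  the hypotheses are the cross-multiplied equality and its derivative; the conclusion makes the
  quotient rule independent of the representation.\<close>

lemma quotient_rule_cross:
  fixes n n' e e' p p' q q' :: "'a::comm_ring_1"
  assumes "n * q' + q * n' = p * e' + e * p'" "n * q = p * e"
  shows "(n' * e - n * e') * (q * q) = (p' * q - p * q') * (e * e)"
proof -
  have "(n' * e - n * e') * (q * q) - (p' * q - p * q') * (e * e) =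
      e * q * ((n * q' + q * n') - (p * e' + e * p')) - (n * q - p * e) * (e' * q + e * q')"
    by (simp add: algebra_simps)
  then show ?thesis using assms by simp
qed

text \<open>For \<open>x\<close> transcendental over \<open>F\<close>, the Euler operator \<open>x d/dx\<close> of \<open>F(x)\<close>, together with the
  constant coefficient of the Laurent expansion at \<open>x = 0\<close>; the latter is the residue of the
  differential form obtained by multiplying with \<open>dx/x\<close>.\<close>

lemma rat_ext_euler_residue:
  fixes x :: "'a::field_char_0"
  assumes F: "is_subfield F" and x: "\<not> algebraic_over F x"
  obtains d \<rho> where "derivation_on (rat_ext F x) d" "\<forall>c\<in>F. d c = 0" "d x = x" "log_residue d F (rat_ext F x) \<rho>"
proof -
  let ?R = "rat_ext F x"
  note R = subfield_rat_ext[OF F, of x]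
  \<comment> \<open>Transcendence of \<open>x\<close> lets identities between polynomials over
    \<open>F\<close> be tested at \<open>x\<close>.\<close>
  have inj: "p = q" if "p \<in> polys_over F" "q \<in> polys_over F" "poly p x = poly q x" for p q
    using x polys_over_diff[OF F that(1,2)] that(3) unfolding algebraic_over_def by auto
  have "\<forall>u\<in>?R. \<exists>p q. p \<in> polys_over F \<and> q \<in> polys_over F \<and> poly q x \<noteq> 0 \<and> u = poly p x / poly q x"
    unfolding rat_ext_def by blast
  then obtain nu de where rep: "\<And>u. u \<in> ?R \<Longrightarrow> nu u \<in> polys_over F" "\<And>u. u \<in> ?R \<Longrightarrow> de u \<in> polys_over F"
    "\<And>u. u \<in> ?R \<Longrightarrow> poly (de u) x \<noteq> 0" "\<And>u. u \<in> ?R \<Longrightarrow> u = poly (nu u) x / poly (de u) x"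
    by metis
  \<comment> \<open>\<open>\<iota>\<close> is the Laurent expansion at \<open>x = 0\<close> and
    \<open>D p q\<close> is \<open>x\<close> times the derivative of \<open>p / q\<close>, both
    formed from a chosen fraction. The facts \<open>\<iota>\<close> and \<open>d\<close> below show
    that any other fraction gives the same result.\<close>
  define \<iota> where "\<iota> u = fls_of_poly (nu u) / fls_of_poly (de u)" for u
  define D where "D p q = poly (pCons 0 (pderiv p * q - p * pderiv q)) x / poly (q * q) x" for p q
  define d where "d u = D (nu u) (de u)" for u
  have nz: "fls_of_poly q \<noteq> 0" if "poly q x \<noteq> 0" for q using that by (auto simp: fls_of_poly_simps)
  have cross: "nu u * q = p * de u"
    if "p \<in> polys_over F" "q \<in> polys_over F" "poly q x \<noteq> 0" "u = poly p x / poly q x" "u \<in> ?R" for p q u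
  proof (rule inj)
    show "nu u * q \<in> polys_over F" "p * de u \<in> polys_over F"
      by (intro polys_over_mult F that rep)+
    have "poly (nu u) x / poly (de u) x = poly p x / poly q x" using that(4) rep(4)[OF that(5)] by simp
    then show "poly (nu u * q) x = poly (p * de u) x"
      using that(3) rep(3)[OF that(5)] by (simp add: frac_eq_eq)
  qed
  have \<iota>: "\<iota> u = fls_of_poly p / fls_of_poly q"
    if pq: "p \<in> polys_over F" "q \<in> polys_over F" "poly q x \<noteq> 0" "u = poly p x / poly q x" for p q u
  proof -
    have u: "u \<in> ?R" using rat_extI[OF pq(1-3)] pq(4) by simp
    have "fls_of_poly (nu u) * fls_of_poly q = fls_of_poly p * fls_of_poly (de u)"
      using cross[OF pq u] by (metis fls_of_poly_simps(3))
    then show ?thesis unfolding \<iota>_def using nz[OF pq(3)] nz[OF rep(3)[OF u]] by (simp add: frac_eq_eq)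
  qed
  have d: "d u = D p q"
    if pq: "p \<in> polys_over F" "q \<in> polys_over F" "poly q x \<noteq> 0" "u = poly p x / poly q x" for p q u
  proof -
    have u: "u \<in> ?R" using rat_extI[OF pq(1-3)] pq(4) by simp
    let ?n = "nu u" and ?e = "de u"
    have c: "?n * q = p * ?e" by (rule cross[OF pq u])
    then have "pderiv (?n * q) = pderiv (p * ?e)" by simp
    then have "poly (?n * pderiv q + q * pderiv ?n) x = poly (p * pderiv ?e + ?e * pderiv p) x"
      by (simp add: pderiv_mult)
    moreover have "poly (?n * q) x = poly (p * ?e) x" using c by simp
    ultimately have e1: "poly ?n x * poly (pderiv q) x + poly q x * poly (pderiv ?n) x
        = poly p x * poly (pderiv ?e) x + poly ?e x * poly (pderiv p) x"
      and e2: "poly ?n x * poly q x = poly p x * poly ?e x" by simp_all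
    have "(poly (pderiv ?n) x * poly ?e x - poly ?n x * poly (pderiv ?e) x) * (poly q x * poly q x) =
      (poly (pderiv p) x * poly q x - poly p x * poly (pderiv q) x) * (poly ?e x * poly ?e x)"
      by (rule quotient_rule_cross[OF e1 e2])
    then show ?thesis
      unfolding d_def D_def using pq(3) rep(3)[OF u] by (simp add: frac_eq_eq)
  qed
  have dR: "d u \<in> ?R" and \<iota>d: "\<iota> (d u) = fls_X * fls_deriv (\<iota> u)" if u: "u \<in> ?R" for u
  proof -
    let ?n = "nu u" and ?e = "de u"
    have in_F: "pCons 0 (pderiv ?n * ?e - ?n * pderiv ?e) \<in> polys_over F" "?e * ?e \<in> polys_over F"
      by (intro polys_over_closed F subfield_0 rep u)+
    have ne: "poly (?e * ?e) x \<noteq> 0" using rep(3)[OF u] by simp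
    show "d u \<in> ?R" unfolding d_def D_def by (rule rat_extI[OF in_F ne])
    have "\<iota> (d u) = fls_of_poly (pCons 0 (pderiv ?n * ?e - ?n * pderiv ?e)) / fls_of_poly (?e * ?e)"
      by (rule \<iota>[OF in_F ne]) (simp add: d_def D_def)
    then show "\<iota> (d u) = fls_X * fls_deriv (\<iota> u)"
      using nz[OF rep(3)[OF u]] unfolding \<iota>_def
      by (simp add: fls_deriv_divide fls_of_poly_simps power2_eq_square)
  qed
  have arith: "\<iota> (u + v) = \<iota> u + \<iota> v" "\<iota> (u * v) = \<iota> u * \<iota> v"
    "d (u + v) = d u + d v" "d (u * v) = d u * v + u * d v" if u: "u \<in> ?R" and v: "v \<in> ?R" for u v
  proof -
    let ?p = "nu u" and ?q = "de u" and ?s = "nu v" and ?t = "de v"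
    have 1: "?p * ?t + ?s * ?q \<in> polys_over F" "?p * ?s \<in> polys_over F" "?q * ?t \<in> polys_over F"
      by (intro polys_over_closed F rep u v)+
    have 2: "poly ?q x \<noteq> 0" "poly ?t x \<noteq> 0" "poly (?q * ?t) x \<noteq> 0" using rep(3) u v by simp_all
    have 3: "u + v = poly (?p * ?t + ?s * ?q) x / poly (?q * ?t) x"
      "u * v = poly (?p * ?s) x / poly (?q * ?t) x"
      using arg_cong2[of _ _ _ _ "(+)", OF rep(4)[OF u] rep(4)[OF v]]
        arg_cong2[of _ _ _ _ "(*)", OF rep(4)[OF u] rep(4)[OF v]] 2
      by (simp_all add: add_frac_eq)
    show "\<iota> (u + v) = \<iota> u + \<iota> v" "\<iota> (u * v) = \<iota> u * \<iota> v"
      using \<iota>[OF 1(1,3) 2(3) 3(1)] \<iota>[OF 1(2,3) 2(3) 3(2)] nz[OF 2(1)] nz[OF 2(2)]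
      by (simp_all add: fls_of_poly_simps \<iota>_def add_frac_eq)
    have "D (?p * ?t + ?s * ?q) (?q * ?t) = D ?p ?q + D ?s ?t"
      unfolding D_def using 2(1,2)
      by (simp add: pderiv_add pderiv_mult add_frac_eq frac_eq_eq) (simp add: algebra_simps)
    then show "d (u + v) = d u + d v"
      using d[OF 1(1,3) 2(3) 3(1)] by (simp add: d_def)
    have "D (?p * ?s) (?q * ?t) = D ?p ?q * (poly ?s x / poly ?t x) + (poly ?p x / poly ?q x) * D ?s ?t"
      unfolding D_def using 2(1,2)
      by (simp add: pderiv_mult add_frac_eq frac_eq_eq) (simp add: algebra_simps)
    then have "d (u * v) = d u * (poly ?s x / poly ?t x) + (poly ?p x / poly ?q x) * d v"
      using d[OF 1(2,3) 2(3) 3(2)] by (simp add: d_def)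
    then show "d (u * v) = d u * v + u * d v" by (simp flip: rep(4)[OF u] rep(4)[OF v])
  qed
  have const: "d c = 0 \<and> \<iota> c = fls_const c" if c: "c \<in> F" for c
  proof -
    have c': "[:c:] \<in> polys_over F" "1 \<in> polys_over F" by (intro polys_over_closed F c)+
    show ?thesis using d[OF c', of c] \<iota>[OF c', of c] by (simp add: D_def fls_of_poly_simps)
  qed
  have X: "d x = x"
  proof -
    have "[:0, 1:] \<in> polys_over F" "1 \<in> polys_over F" by (intro polys_over_closed subfield_closed F)+
    from d[OF this, of x] show ?thesis by (simp add: D_def pderiv_pCons)
  qed
  have der: "derivation_on ?R d" unfolding derivation_on_def using arith by blast
  define \<rho> where "\<rho> u = fls_nth (\<iota> u) 0" for u
  have "\<rho> (d f / f) \<in> \<int>" if f: "f \<in> ?R" "f \<noteq> 0" for f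
  proof -
    have fi: "inverse f \<in> ?R" by (rule subfield_inverse[OF R f(1)])
    have one: "\<iota> f * \<iota> (inverse f) = 1"
      using arith(2)[OF f(1) fi] f const[OF subfield_1[OF F]] by simp
    then have "\<iota> f \<noteq> 0" "\<iota> (inverse f) = inverse (\<iota> f)" by (auto simp: inverse_unique)
    then have "\<iota> (d f / f) = fls_X * (fls_deriv (\<iota> f) * inverse (\<iota> f))"
      using arith(2)[OF dR[OF f(1)] fi] \<iota>d[OF f(1)] by (simp add: divide_inverse mult.assoc)
    \<comment> \<open>Multiplying by \<open>fls_X\<close> shifts the coefficient at -1 to 0, so this
      is the residue of a logarithmic derivative, which is the order of the series.\<close>
    then have "\<rho> (d f / f) = fls_residue (fls_deriv (\<iota> f) * inverse (\<iota> f))"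
      unfolding \<rho>_def by (simp add: fls_X_times_conv_shift)
    then show ?thesis using \<open>\<iota> f \<noteq> 0\<close> by (simp only: fls_residue_deriv_times_inverse_eq_subdegree) simp
  qed
  \<comment> \<open>The same shift: the derivative of a Laurent series has no coefficient at
    -1.\<close>
  moreover have "\<rho> (d v) = 0" if "v \<in> ?R" for v
    using \<iota>d[OF that] by (simp add: \<rho>_def fls_X_times_conv_shift)
  moreover have "\<rho> 1 = 1" using const[OF subfield_1[OF F]] by (simp add: \<rho>_def)
  moreover have "\<rho> (c * u) = c * \<rho> u" if "c \<in> F" "u \<in> ?R" for c u
    using arith(2)[OF _ that(2), of c] rat_ext_base[OF F, of x] const[OF that(1)] that by (auto simp: \<rho>_def)
  ultimately have "log_residue d F ?R \<rho>"
    unfolding log_residue_def using R rat_ext_base[OF F, of x] dR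
    by (auto simp: arith(1)) (simp add: \<rho>_def arith(1))
  then show ?thesis using that der const X by blast
qed


subsection \<open>Fields algebraic over a rational function field\<close>

text \<open>Exchange: clear denominators in an equation for \<open>x\<close> over
  \<open>F(a)\<close> and read it as an equation \<open>G\<close> for \<open>a\<close> over
  \<open>F[x]\<close>. If \<open>G\<close> were zero, transcendence of \<open>x\<close> would make
  all \<open>h i\<close> zero, but the top one does not vanish at \<open>a\<close>.\<close>

lemma algebraic_over_rat_ext_swap:
  fixes x a :: "'a::field"
  assumes F: "is_subfield F" and x: "\<not> algebraic_over F x" and alg: "algebraic_over (rat_ext F a) x"
  shows "algebraic_over (rat_ext F x) a"
proof -
  obtain Q where Q: "Q \<in> polys_over (rat_ext F a)" "Q \<noteq> 0" "poly Q x = 0"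
    using alg unfolding algebraic_over_def by blast
  have "\<forall>i. \<exists>p q. p \<in> polys_over F \<and> q \<in> polys_over F \<and> poly q a \<noteq> 0 \<and> coeff Q i = poly p a / poly q a"
    using polys_over_coeff[OF Q(1)] unfolding rat_ext_def by blast
  then obtain p q where pq: "\<And>i. p i \<in> polys_over F" "\<And>i. q i \<in> polys_over F" "\<And>i. poly (q i) a \<noteq> 0"
    "\<And>i. coeff Q i = poly (p i) a / poly (q i) a" by metis
  let ?N = "degree Q"
  define c where "c = (\<Prod>i\<le>?N. poly (q i) a)"
  define h where "h i = p i * (\<Prod>k\<in>{..?N} - {i}. q k)" for i
  have prod_in: "(\<Prod>k\<in>A. q k) \<in> polys_over F" for A :: "nat set"
    by (induction A rule: infinite_finite_induct) (auto intro!: polys_over_closed F pq)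
  have hF: "h i \<in> polys_over F" for i unfolding h_def by (intro polys_over_mult F pq prod_in)
  have "c \<noteq> 0" using pq(3) by (simp add: c_def)
  have h: "poly (h i) a = coeff Q i * c" if "i \<le> ?N" for i
  proof -
    have "c = poly (q i) a * (\<Prod>k\<in>{..?N} - {i}. poly (q k) a)"
      unfolding c_def using that by (simp add: prod.remove)
    then show ?thesis using pq(3,4)[of i] by (simp add: h_def poly_prod)
  qed
  define G where "G = (\<Sum>i\<le>?N. Polynomial.smult (x ^ i) (h i))"
  have "poly G a = (\<Sum>i\<le>?N. coeff Q i * x ^ i) * c"
    unfolding G_def poly_sum sum_distrib_right by (intro sum.cong) (auto simp: h)
  then have "poly G a = 0" using Q(3) by (simp add: poly_altdef)
  moreover have "G \<noteq> 0"
  proof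
    assume "G = 0"
    have "coeff (h i) j = 0" if i: "i \<le> ?N" for i j
    proof -
      define S where "S = (\<Sum>i\<le>?N. monom (coeff (h i) j) i)"
      have co: "coeff S k = (if k \<le> ?N then coeff (h k) j else 0)" for k
        by (simp add: S_def coeff_sum)
      have "S \<in> polys_over F"
        using hF subfield_0[OF F] by (auto simp: polys_over_def co)
      moreover have "poly S x = coeff G j"
        by (simp add: S_def G_def poly_sum poly_monom coeff_sum mult.commute)
      ultimately have "S = 0" using x \<open>G = 0\<close> unfolding algebraic_over_def by auto
      then show ?thesis using co[of i] i by simp
    qed
    then have "h ?N = 0" by (intro poly_eqI) simp
    then show False using h[of ?N] \<open>c \<noteq> 0\<close> Q(2) by simp
  qed
  moreover have "G \<in> polys_over (rat_ext F x)"
  proof -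
    have "coeff G j = (\<Sum>i\<le>?N. x ^ i * coeff (h i) j)" for j
      by (simp add: G_def coeff_sum)
    moreover have "coeff (h i) j \<in> rat_ext F x" for i j
      using polys_over_coeff[OF hF] rat_ext_base[OF F] by blast
    ultimately show ?thesis
      unfolding polys_over_def
      by (auto intro!: subfield_closed[OF subfield_rat_ext[OF F]] rat_ext_generator[OF F])
  qed
  ultimately show ?thesis unfolding algebraic_over_def by blast
qed

text \<open>Zorn's lemma. If \<open>x\<close> is algebraic over \<open>F(a)\<close>, exchange makes
  \<open>a\<close> algebraic over \<open>F(x)\<close>; otherwise maximality puts \<open>a\<close>
  into \<open>F\<close>.\<close>

lemma maximal_subfield_transcendental:
  fixes x :: "'a::field"
  assumes C: "is_subfield C" and x: "\<not> algebraic_over C x"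
  obtains F where "is_subfield F" "C \<subseteq> F" "\<not> algebraic_over F x" "\<And>a. algebraic_over (rat_ext F x) a"
proof -
  define \<A> where "\<A> = {F. is_subfield F \<and> C \<subseteq> F \<and> \<not> algebraic_over F x}"
  have "C \<in> \<A>" using C x by (simp add: \<A>_def)
  have "\<Union>\<C> \<in> \<A>" if "\<C> \<noteq> {}" and chain: "subset.chain \<A> \<C>" for \<C>
  proof -
    have sub: "\<C> \<subseteq> \<A>" using chain by (simp add: subset_chain_def)
    have common: "\<exists>B\<in>\<C>. A \<subseteq> B" if "finite A" "A \<subseteq> \<Union>\<C>" for A
      using finite_subset_Union_chain[OF that \<open>\<C> \<noteq> {}\<close> chain] by blast
    have "is_subfield (\<Union>\<C>)"
    proof -
      have two: "u + v \<in> \<Union>\<C> \<and> u * v \<in> \<Union>\<C> \<and> - u \<in> \<Union>\<C> \<and> inverse u \<in> \<Union>\<C>"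
        if uv: "u \<in> \<Union>\<C>" "v \<in> \<Union>\<C>" for u v
      proof -
        obtain B where "B \<in> \<C>" "u \<in> B" "v \<in> B" using common[of "{u, v}"] uv by auto
        moreover from this sub have "is_subfield B" by (auto simp: \<A>_def)
        ultimately show ?thesis by (auto intro: subfield_closed)
      qed
      obtain B where "B \<in> \<C>" using \<open>\<C> \<noteq> {}\<close> by blast
      then have "0 \<in> \<Union>\<C>" "1 \<in> \<Union>\<C>" using sub by (auto simp: \<A>_def intro: subfield_closed)
      then show ?thesis using two unfolding is_subfield_def by blast
    qed
    moreover have "C \<subseteq> \<Union>\<C>" using sub \<open>\<C> \<noteq> {}\<close> by (auto simp: \<A>_def)
    moreover have "\<not> algebraic_over (\<Union>\<C>) x"
    proof
      assume "algebraic_over (\<Union>\<C>) x"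
      then obtain p where p: "p \<in> polys_over (\<Union>\<C>)" "p \<noteq> 0" "poly p x = 0"
        unfolding algebraic_over_def by blast
      \<comment> \<open>An equation for \<open>x\<close> has finitely many coefficients, so it
        already lives over one member of the chain.\<close>
      have "finite (range (coeff p))"
      proof -
        have "range (coeff p) \<subseteq> insert 0 (coeff p ` {..degree p})"
        proof
          fix u assume "u \<in> range (coeff p)"
          then obtain k where "u = coeff p k" by blast
          then show "u \<in> insert 0 (coeff p ` {..degree p})"
            by (cases "k \<le> degree p") (auto simp: coeff_eq_0)
        qed
        then show ?thesis by (rule finite_subset) simp
      qed
      then obtain B where "B \<in> \<C>" "range (coeff p) \<subseteq> B"
        using common[of "range (coeff p)"] p(1) by (auto simp: polys_over_def)
      then have "p \<in> polys_over B" "B \<in> \<A>" using sub by (auto simp: polys_over_def)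
      then show False using p unfolding \<A>_def algebraic_over_def by blast
    qed
    ultimately show ?thesis by (simp add: \<A>_def)
  qed
  then obtain F where F: "F \<in> \<A>" and max: "\<And>G. G \<in> \<A> \<Longrightarrow> F \<subseteq> G \<Longrightarrow> G = F"
    using subset_Zorn_nonempty[of \<A>] \<open>C \<in> \<A>\<close> by blast
  have F': "is_subfield F" "C \<subseteq> F" "\<not> algebraic_over F x" using F by (auto simp: \<A>_def)
  have "algebraic_over (rat_ext F x) a" for a
  proof (cases "algebraic_over (rat_ext F a) x")
    case True
    then show ?thesis by (rule algebraic_over_rat_ext_swap[OF F'(1,3)])
  next
    case False
    then have "rat_ext F a \<in> \<A>"
      using subfield_rat_ext[OF F'(1)] rat_ext_base[OF F'(1), of a] F'(2) by (auto simp: \<A>_def)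
    then have "rat_ext F a = F" using max rat_ext_base[OF F'(1)] by blast
    then have "a \<in> rat_ext F x" using rat_ext_generator[OF F'(1)] rat_ext_base[OF F'(1)] by blast
    then have "[:-a, 1:] \<in> polys_over (rat_ext F x)"
      using subfield_rat_ext[OF F'(1)] by (intro polys_over_closed subfield_closed)
    then show ?thesis unfolding algebraic_over_def by (intro bexI) auto
  qed
  then show ?thesis using that F' by blast
qed

text \<open>The Euler operator of \<open>F(x)\<close> extends to the whole field, which is algebraic
  over \<open>F(x)\<close>; the residue is extended only as far as the given finite set
  requires.\<close>

lemma euler_derivation_residue:
  fixes x :: "'a::field_char_0"
  assumes C: "is_subfield C" and x: "\<not> algebraic_over C x" and "finite A"
  obtains \<theta> E \<rho> where "derivation_on UNIV \<theta>" "\<forall>c\<in>C. \<theta> c = 0" "\<theta> x = x"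
    "log_residue \<theta> C E \<rho>" "A \<subseteq> E"
proof -
  obtain F where F: "is_subfield F" "C \<subseteq> F" "\<not> algebraic_over F x" and alg: "\<And>a. algebraic_over (rat_ext F x) a"
    using maximal_subfield_transcendental[OF C x] by blast
  note R = subfield_rat_ext[OF F(1), of x]
  obtain d \<rho> where d: "derivation_on (rat_ext F x) d" "\<forall>c\<in>F. d c = 0" "d x = x"
    and \<rho>: "log_residue d F (rat_ext F x) \<rho>"
    using rat_ext_euler_residue[OF F(1,3)] by blast
  obtain \<theta> where \<theta>: "derivation_on UNIV \<theta>" "\<forall>u\<in>rat_ext F x. \<theta> u = d u"
    using derivation_algebraic_ext[OF R d(1) alg] by blast
  have "log_residue \<theta> F (rat_ext F x) \<rho>" using \<rho> \<theta>(2) by (simp add: log_residue_def)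
  then obtain E \<rho>' where "A \<subseteq> E" "log_residue \<theta> F E \<rho>'"
    using log_residue_finite_ext[OF \<theta>(1) _ assms(3) alg] by blast
  moreover have "\<theta> x = x" using \<theta>(2) d(3) rat_ext_generator[OF F(1)] by simp
  moreover have "\<forall>c\<in>C. \<theta> c = 0" using \<theta>(2) d(2) F(2) rat_ext_base[OF F(1), of x] by (auto simp: subset_iff)
  ultimately show ?thesis using that \<theta>(1) log_residue_mono[OF _ F(2)] by blast
qed


subsection \<open>Ax's theorem\<close>

lemma derivation_der: "derivation_on UNIV (der :: 'a::differential_field \<Rightarrow> 'a)"
  by (simp add: derivation_on_def der_add der_mult)

lemma subfield_constants: "is_subfield (constants :: 'a::differential_field set)"
  unfolding constants_def by (rule derivation_kernel_subfield[OF derivation_der])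

section \<open>Combinations of derivations, and logarithmic derivatives\<close>

lemma derivation_linear_combination:
  assumes "\<And>i. i \<in> I \<Longrightarrow> derivation_on UNIV (v i)"
  shows "derivation_on UNIV (\<lambda>x. \<Sum>i\<in>I. a i * v i x)"
proof -
  have "(\<Sum>i\<in>I. a i * v i (x + y)) = (\<Sum>i\<in>I. a i * v i x) + (\<Sum>i\<in>I. a i * v i y)" for x y
    unfolding sum.distrib[symmetric]
    using assms by (intro sum.cong) (auto simp: derivation_on_def distrib_left)
  moreover have "(\<Sum>i\<in>I. a i * v i (x * y)) = (\<Sum>i\<in>I. a i * v i x) * y + x * (\<Sum>i\<in>I. a i * v i y)" for x y
    unfolding sum_distrib_left sum_distrib_right sum.distrib[symmetric]
    using assms by (intro sum.cong) (auto simp: derivation_on_def algebra_simps)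
  ultimately show ?thesis by (simp add: derivation_on_def)
qed

lemma derivation_commutator:
  assumes "derivation_on UNIV d" "derivation_on UNIV d'"
  shows "derivation_on UNIV (\<lambda>x. d (d' x) - d' (d x))"
  using assms by (simp add: derivation_on_def algebra_simps)

lemma log_derivation_mult:
  assumes "derivation_on UNIV d" "x \<noteq> 0" "y \<noteq> 0"
  shows "d (x * y) / (x * y) = d x / x + d y / y"
  using assms by (simp add: derivation_on_def field_simps)

lemma log_derivation_power_int:
  fixes d :: "'a::field \<Rightarrow> 'a"
  assumes d: "derivation_on UNIV d" and x: "x \<noteq> 0"
  shows "d (x powi k) / x powi k = of_int k * (d x / x)"
proof -
  have nat: "d (x ^ j) / x ^ j = of_nat j * (d x / x)" for j
  proof (induction j)
    case 0
    then show ?case by (simp add: derivation_1[OF subfield_UNIV d])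
  next
    case (Suc j)
    then show ?case using log_derivation_mult[OF d x, of "x ^ j"] x by (simp add: add_divide_distrib algebra_simps)
  qed
  show ?thesis
  proof (cases k rule: int_cases2)
    case (nonneg j)
    then show ?thesis using nat[of j] by simp
  next
    case (nonpos j)
    have "d (inverse (x ^ j)) / inverse (x ^ j) = - (d (x ^ j) / x ^ j)"
      using x by (simp add: derivation_inverse[OF subfield_UNIV d] power2_eq_square)
    then show ?thesis using nat[of j] nonpos by (simp add: power_int_minus)
  qed
qed

lemma log_derivation_prod:
  fixes d :: "'a::field \<Rightarrow> 'a"
  assumes d: "derivation_on UNIV d" and "finite I" "\<And>i. i \<in> I \<Longrightarrow> f i \<noteq> 0"
  shows "d (prod f I) / prod f I = (\<Sum>i\<in>I. d (f i) / f i)"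
  using assms(2,3)
proof (induction I rule: finite_induct)
  case empty
  then show ?case by (simp add: derivation_1[OF subfield_UNIV d])
next
  case (insert i I)
  then show ?case using log_derivation_mult[OF d, of "f i" "prod f I"] by simp
qed

lemma common_denominator:
  fixes m :: "'i \<Rightarrow> rat"
  assumes "finite I"
  obtains N :: int and k :: "'i \<Rightarrow> int" where "N \<noteq> 0" "\<And>i. i \<in> I \<Longrightarrow> of_int (k i) = of_int N * m i"
proof -
  define den where "den i = snd (quotient_of (m i))" for i
  define N where "N = prod den I"
  have den: "den i \<noteq> 0" for i using quotient_of_denom_pos'[of "m i"] by (simp add: den_def)
  have "\<exists>k :: int. of_int k = of_int N * m i" if i: "i \<in> I" for i
  proof -
    have "of_int (den i) * m i = of_int (fst (quotient_of (m i)))"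
      using quotient_of_div[of "m i" "fst (quotient_of (m i))" "den i"] den[of i]
      by (simp add: den_def field_simps)
    moreover have "N = den i * prod den (I - {i})"
      unfolding N_def using assms i by (simp add: prod.remove)
    ultimately have "of_int N * m i = of_int (fst (quotient_of (m i)) * prod den (I - {i}))"
      by simp
    then show ?thesis by metis
  qed
  then obtain k where "\<And>i. i \<in> I \<Longrightarrow> of_int (k i) = of_int N * m i" by metis
  moreover have "N \<noteq> 0" using den assms by (simp add: N_def)
  ultimately show ?thesis using that by blast
qed

text \<open>In terms of differential forms: if all \<open>\<delta> (e z) / e z - \<delta> z\<close> satisfy a linear relation with
  coefficients in \<open>K\<close>, a shortest such relation has constant coefficients, since the forms
  \<open>d(e z)/(e z) - dz\<close> are annihilated by the Lie derivative along \<open>D\<close>.\<close>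

lemma constant_relation_exists:
  fixes e :: "'a::differential_field \<Rightarrow> 'a" and w :: "'a \<Rightarrow> 'a"
  defines "Der \<equiv> {\<delta>. derivation_on UNIV \<delta> \<and> (\<forall>c\<in>constants. \<delta> c = 0)}"
  assumes fin: "finite Z" and e: "\<And>z. z \<in> Z \<Longrightarrow> e z \<noteq> 0" "\<And>z. z \<in> Z \<Longrightarrow> der (e z) = e z * der z"
    and w: "\<exists>z\<in>Z. w z \<noteq> 0" "\<forall>\<delta>\<in>Der. (\<Sum>z\<in>Z. w z * (\<delta> (e z) / e z - \<delta> z)) = 0"
  obtains c where "\<forall>z\<in>Z. c z \<in> constants" "\<exists>z\<in>Z. c z \<noteq> 0"
    "\<forall>\<delta>\<in>Der. (\<Sum>z\<in>Z. c z * (\<delta> (e z) / e z - \<delta> z)) = 0"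
proof -
  define rel where "rel w \<longleftrightarrow> (\<forall>\<delta>\<in>Der. (\<Sum>z\<in>Z. w z * (\<delta> (e z) / e z - \<delta> z)) = 0)" for w
  let ?supp = "\<lambda>w. {z\<in>Z. w z \<noteq> 0}"
  let ?Q = "\<lambda>w. (\<exists>z\<in>Z. w z \<noteq> 0) \<and> rel w"
  note D = subfield_UNIV derivation_der
  have "?Q w" using w by (simp add: rel_def)
  from ex_has_least_nat[of ?Q w "\<lambda>w. card (?supp w)", OF this] obtain v
    where v: "?Q v" and least: "\<And>w'. ?Q w' \<Longrightarrow> card (?supp v) \<le> card (?supp w')" by blast
  obtain z0 where z0: "z0 \<in> Z" "v z0 \<noteq> 0" using v by blast
  \<comment> \<open>Normalised to \<open>c z0 = 1\<close>, so that differentiating the coefficients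
    removes \<open>z0\<close> from the support; minimality then forces all derivatives to
    vanish.\<close>
  define c where "c z = v z / v z0" for z
  have relc: "rel c"
    unfolding rel_def
  proof
    fix \<delta> assume "\<delta> \<in> Der"
    then have "(\<Sum>z\<in>Z. v z * (\<delta> (e z) / e z - \<delta> z)) / v z0 = 0" using v by (simp add: rel_def)
    then show "(\<Sum>z\<in>Z. c z * (\<delta> (e z) / e z - \<delta> z)) = 0" by (simp add: c_def sum_divide_distrib)
  qed
  have "rel (\<lambda>z. der (c z))"
    unfolding rel_def
  proof
    fix \<delta> assume \<delta>: "\<delta> \<in> Der"
    then have d: "derivation_on UNIV \<delta>" and d0: "\<forall>c\<in>constants. \<delta> c = 0" by (auto simp: Der_def)
    note U = subfield_UNIV d
    \<comment> \<open>The commutator of \<open>der\<close> and \<open>\<delta>\<close> is again a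
      derivation that kills the constants; by \<open>swap\<close>, differentiating the vector of
      \<open>\<delta>\<close> gives the vector of \<open>\<eta>\<close>.\<close>
    define \<eta> where "\<eta> x = der (\<delta> x) - \<delta> (der x)" for x
    have "\<eta> \<in> Der"
      using derivation_commutator[OF derivation_der d] d0
      by (auto simp: Der_def \<eta>_def[abs_def] constants_def derivation_0[OF U])
    have swap: "der (\<delta> (e z) / e z - \<delta> z) = \<eta> (e z) / e z - \<eta> z" if z: "z \<in> Z" for z
    proof -
      have "der (\<delta> (e z) / e z) = (der (\<delta> (e z)) * e z - \<delta> (e z) * (e z * der z)) / (e z) ^ 2"
        using derivation_divide[OF D, of "\<delta> (e z)" "e z"] e[OF z] by simp
      then have "der (\<delta> (e z) / e z - \<delta> z) =
          (der (\<delta> (e z)) * e z - \<delta> (e z) * (e z * der z)) / (e z) ^ 2 - der (\<delta> z)"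
        by (simp add: der_diff)
      also have "\<dots> = \<eta> (e z) / e z - \<eta> z"
        unfolding \<eta>_def e(2)[OF z] derivation_mult[OF U UNIV_I UNIV_I]
        using e(1)[OF z] by (simp add: field_simps power2_eq_square)
      finally show ?thesis .
    qed
    have "0 = der (\<Sum>z\<in>Z. c z * (\<delta> (e z) / e z - \<delta> z))" using relc \<delta> by (simp add: rel_def)
    also have "\<dots> = (\<Sum>z\<in>Z. der (c z) * (\<delta> (e z) / e z - \<delta> z) + c z * (\<eta> (e z) / e z - \<eta> z))"
      by (simp add: derivation_sum[OF D] der_mult swap)
    also have "\<dots> = (\<Sum>z\<in>Z. der (c z) * (\<delta> (e z) / e z - \<delta> z))"
      using relc \<open>\<eta> \<in> Der\<close> by (simp add: sum.distrib rel_def)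
    finally show "(\<Sum>z\<in>Z. der (c z) * (\<delta> (e z) / e z - \<delta> z)) = 0" by simp
  qed
  moreover have "card (?supp (\<lambda>z. der (c z))) < card (?supp v)"
  proof (rule psubset_card_mono)
    have "z0 \<notin> ?supp (\<lambda>z. der (c z))" using z0 by (simp add: c_def)
    moreover have "?supp (\<lambda>z. der (c z)) \<subseteq> ?supp v" by (auto simp: c_def)
    ultimately show "?supp (\<lambda>z. der (c z)) \<subset> ?supp v" using z0 by blast
  qed (use fin in auto)
  ultimately have "\<forall>z\<in>Z. der (c z) = 0" using least[of "\<lambda>z. der (c z)"] by (meson not_less)
  then have "\<forall>z\<in>Z. c z \<in> constants" by (simp add: constants_def)
  moreover have "\<exists>z\<in>Z. c z \<noteq> 0" using z0 by (intro bexI[of _ z0]) (auto simp: c_def)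
  ultimately show ?thesis using that relc unfolding rel_def by blast
qed

text \<open>The relation is refuted by testing it on the Euler derivation of one product of powers
  of the \<open>e z\<close>, where integrality of residues turns it into a relation over the
  integers.\<close>

lemma no_constant_relation:
  fixes e c :: "'a::differential_field \<Rightarrow> 'a"
  assumes fin: "finite Z" and e: "\<And>z. z \<in> Z \<Longrightarrow> e z \<noteq> 0" "\<And>z. z \<in> Z \<Longrightarrow> der (e z) = e z * der z"
    and ind: "\<And>k :: 'a \<Rightarrow> int. (\<Sum>z\<in>Z. of_int (k z) * z) \<in> constants \<Longrightarrow> \<forall>z\<in>Z. k z = 0"
    and c: "\<forall>z\<in>Z. c z \<in> constants" "\<exists>z\<in>Z. c z \<noteq> 0"
  shows "\<exists>\<delta>. derivation_on UNIV \<delta> \<and> (\<forall>a\<in>constants. \<delta> a = 0) \<and>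
    (\<Sum>z\<in>Z. c z * (\<delta> (e z) / e z - \<delta> z)) \<noteq> 0"
proof (rule ccontr)
  assume contra: "\<not> ?thesis"
  define W where "W = {q :: 'a \<Rightarrow> rat. (\<Sum>z\<in>Z. c z * of_rat (q z)) = 0}"
  obtain z0 where z0: "z0 \<in> Z" "c z0 \<noteq> 0" using c(2) by blast
  \<comment> \<open>\<open>W\<close> is a proper subspace, since \<open>c z0 \<noteq> 0\<close>
    keeps the unit vector at \<open>z0\<close> out of it. Hence it has a nonzero rational
    annihilator \<open>m\<close>, which is scaled to the integer vector \<open>k\<close>.\<close>
  have "\<not> (\<exists>q\<in>W. \<forall>z\<in>Z. q z = (if z = z0 then 1 else 0))"
  proof
    assume "\<exists>q\<in>W. \<forall>z\<in>Z. q z = (if z = z0 then 1 else 0)"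
    then obtain q where q: "q \<in> W" "\<forall>z\<in>Z. q z = (if z = z0 then 1 else 0)" by blast
    have "(\<Sum>z\<in>Z. c z * of_rat (q z)) = (\<Sum>z\<in>Z. if z = z0 then c z0 else 0)"
      using q(2) by (intro sum.cong) auto
    then show False using q(1) z0 fin by (simp add: W_def)
  qed
  then have not_surj: "\<not> (\<forall>g. \<exists>q\<in>W. \<forall>z\<in>Z. q z = g z)"
    by (rule contrapos_nn) (erule spec)
  have "(\<exists>m. (\<exists>z\<in>Z. m z \<noteq> 0) \<and> (\<forall>q\<in>W. (\<Sum>z\<in>Z. m z * q z) = 0)) \<or> (\<forall>g. \<exists>q\<in>W. \<forall>z\<in>Z. q z = g z)"
  proof (rule annihilator_or_surjective[OF fin])
    show "(\<lambda>z. f z + g z) \<in> W" if "f \<in> W" "g \<in> W" for f g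
      using that by (simp add: W_def of_rat_add distrib_left sum.distrib)
    show "(\<lambda>z. a * f z) \<in> W" if "f \<in> W" for a f
    proof -
      have "(\<Sum>z\<in>Z. c z * of_rat (a * f z)) = of_rat a * (\<Sum>z\<in>Z. c z * of_rat (f z))"
        by (simp add: of_rat_mult sum_distrib_left mult_ac)
      then show ?thesis using that by (simp add: W_def)
    qed
    have "(\<lambda>_. 0) \<in> W" by (simp add: W_def)
    then show "W \<noteq> {}" by blast
  qed
  then obtain m where m: "\<exists>z\<in>Z. m z \<noteq> 0" "\<forall>q\<in>W. (\<Sum>z\<in>Z. m z * q z) = 0" using not_surj by blast
  obtain N k where N: "N \<noteq> 0" and k: "\<And>z. z \<in> Z \<Longrightarrow> of_int (k z) = of_int N * m z"
    using common_denominator[OF fin, of m] by blast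
  have k0: "\<exists>z\<in>Z. k z \<noteq> 0"
  proof -
    obtain z where "z \<in> Z" "m z \<noteq> 0" using m(1) by blast
    then have "(of_int (k z) :: rat) \<noteq> 0" using k N by simp
    then show ?thesis using \<open>z \<in> Z\<close> by auto
  qed
  define X where "X = (\<Prod>z\<in>Z. e z powi k z)"
  have X0: "X \<noteq> 0" using e(1) fin by (simp add: X_def)
  have logX: "d X / X = (\<Sum>z\<in>Z. of_int (k z) * (d (e z) / e z))" if "derivation_on UNIV d" for d
    unfolding X_def using e(1)
    by (subst log_derivation_prod[OF that fin]) (auto simp: log_derivation_power_int[OF that])
  \<comment> \<open>The logarithmic derivative of \<open>X\<close> is the derivative of the integer
    combination of the \<open>z\<close> with coefficients \<open>k z\<close>, so a constant
    \<open>X\<close> would violate \<open>ind\<close>.\<close>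
  have "der X \<noteq> 0"
  proof
    assume "der X = 0"
    then have "(\<Sum>z\<in>Z. of_int (k z) * (der (e z) / e z)) = 0" using logX[OF derivation_der] by simp
    moreover have "(\<Sum>z\<in>Z. of_int (k z) * (der (e z) / e z)) = der (\<Sum>z\<in>Z. of_int (k z) * z)"
      using e by (simp add: derivation_sum[OF subfield_UNIV derivation_der] der_mult)
    ultimately have "(\<Sum>z\<in>Z. of_int (k z) * z) \<in> constants" by (simp only: constants_def mem_Collect_eq)
    from ind[OF this] show False using k0 by blast
  qed
  then have X: "\<not> algebraic_over constants X"
    using derivation_algebraic_eq_0[OF subfield_constants derivation_der] by (auto simp: constants_def)
  have "finite (Z \<union> e ` Z)" using fin by simp
  then obtain \<theta> E \<rho> where \<theta>: "derivation_on UNIV \<theta>" "\<forall>a\<in>constants. \<theta> a = 0" "\<theta> X = X"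
    and \<rho>: "log_residue \<theta> constants E \<rho>" and ZE: "Z \<union> e ` Z \<subseteq> E"
    by (rule euler_derivation_residue[OF subfield_constants X])
  note U = subfield_UNIV \<theta>(1)
  have E: "is_subfield E" and CE: "constants \<subseteq> E" and st: "\<And>x. x \<in> E \<Longrightarrow> \<theta> x \<in> E"
    and add: "\<And>x y. x \<in> E \<Longrightarrow> y \<in> E \<Longrightarrow> \<rho> (x + y) = \<rho> x + \<rho> y"
    and scale: "\<And>a x. a \<in> constants \<Longrightarrow> x \<in> E \<Longrightarrow> \<rho> (a * x) = a * \<rho> x"
    and exact: "\<And>v. v \<in> E \<Longrightarrow> \<rho> (\<theta> v) = 0"
    and log: "\<And>f. f \<in> E \<Longrightarrow> f \<noteq> 0 \<Longrightarrow> \<rho> (\<theta> f / f) \<in> \<int>" and one: "\<rho> 1 \<noteq> 0"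
    using \<rho> by (auto simp: log_residue_def)
  have "\<rho> 0 = 0" using add[of 0 0] subfield_0[OF E] by simp
  have \<rho>_sum: "\<rho> (\<Sum>z\<in>A. f z) = (\<Sum>z\<in>A. \<rho> (f z))" if "\<And>z. z \<in> A \<Longrightarrow> f z \<in> E" for A and f :: "'a \<Rightarrow> 'a"
    using that by (induction A rule: infinite_finite_induct)
      (auto simp: add \<open>\<rho> 0 = 0\<close> subfield_sum[OF E])
  have logE: "\<theta> (e z) / e z \<in> E" if "z \<in> Z" for z
    using that ZE by (intro subfield_divide[OF E] st) auto
  have "\<forall>z\<in>Z. \<exists>n :: int. \<rho> (\<theta> (e z) / e z) = of_int n"
  proof
    fix z assume "z \<in> Z"
    then have "\<rho> (\<theta> (e z) / e z) \<in> \<int>" using ZE by (intro log e(1)) auto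
    then show "\<exists>n. \<rho> (\<theta> (e z) / e z) = of_int n" by (auto elim: Ints_cases)
  qed
  then obtain n :: "'a \<Rightarrow> int" where n: "\<And>z. z \<in> Z \<Longrightarrow> \<rho> (\<theta> (e z) / e z) = of_int (n z)" by metis
  \<comment> \<open>Integers are constants, so this serves both for the relation \<open>c\<close>
    and for the vector \<open>k\<close>.\<close>
  have lin: "\<rho> (\<Sum>z\<in>Z. a z * (\<theta> (e z) / e z)) = (\<Sum>z\<in>Z. a z * of_int (n z))"
    if "\<And>z. z \<in> Z \<Longrightarrow> a z \<in> constants" for a
    using that CE logE by (subst \<rho>_sum) (auto simp: scale n simp del: times_divide_eq_right intro!: subfield_mult[OF E])
  have "(\<Sum>z\<in>Z. c z * (\<theta> (e z) / e z - \<theta> z)) = 0" using contra \<theta>(1,2) by blast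
  then have "(\<Sum>z\<in>Z. c z * (\<theta> (e z) / e z)) = (\<Sum>z\<in>Z. c z * \<theta> z)"
    by (simp add: right_diff_distrib sum_subtractf)
  \<comment> \<open>As \<open>\<theta>\<close> kills the \<open>c z\<close>, this part of the
    relation is a derivative and has residue zero.\<close>
  also have "\<dots> = \<theta> (\<Sum>z\<in>Z. c z * z)"
    using c(1) \<theta>(2) by (simp add: derivation_sum[OF U] derivation_mult[OF U])
  finally have "\<rho> (\<Sum>z\<in>Z. c z * (\<theta> (e z) / e z)) = 0"
    using exact[of "\<Sum>z\<in>Z. c z * z"] ZE CE c(1) by (simp add: subset_iff subfield_sum[OF E] subfield_mult[OF E])
  then have "(\<lambda>z. of_int (n z)) \<in> W" using lin[of c] c(1) by (simp add: W_def)
  then have "(\<Sum>z\<in>Z. m z * of_int (n z)) = 0" by (rule bspec[OF m(2)])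
  then have "of_int N * (\<Sum>z\<in>Z. m z * of_int (n z)) = 0" by simp
  then have "(\<Sum>z\<in>Z. of_int N * m z * of_int (n z)) = 0" by (simp add: sum_distrib_left mult.assoc)
  then have "(\<Sum>z\<in>Z. of_int (k z) * of_int (n z) :: rat) = 0" by (simp add: k)
  then have "of_int (\<Sum>z\<in>Z. k z * n z) = (0 :: rat)" by simp
  then have "(\<Sum>z\<in>Z. k z * n z) = 0" by (simp only: of_int_eq_0_iff)
  \<comment> \<open>From \<open>\<theta> X = X\<close>, the logarithmic derivative of
    \<open>X\<close> is 1.\<close>
  moreover have "\<rho> 1 = of_int (\<Sum>z\<in>Z. k z * n z)"
    using lin[of "\<lambda>z. of_int (k z)"] logX[OF \<theta>(1)] \<theta>(3) X0 by (simp add: constants_def)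
  ultimately show False using one by simp
qed

text \<open>Ax's theorem by counting: if a transcendence basis \<open>S\<close> of these elements
  had at most \<open>card Z\<close> members, the vectors \<open>u \<delta>\<close> could not fill
  the coordinate space, so they would satisfy a linear relation; it can be made constant, which is
  impossible.\<close>

theorem ax_schanuel:
  fixes e :: "'a::differential_field \<Rightarrow> 'a"
  assumes fin: "finite Z" "Z \<noteq> {}"
    and e: "\<And>z. z \<in> Z \<Longrightarrow> e z \<noteq> 0" "\<And>z. z \<in> Z \<Longrightarrow> der (e z) = e z * der z"
    and ind: "\<And>k :: 'a \<Rightarrow> int. (\<Sum>z\<in>Z. of_int (k z) * z) \<in> constants \<Longrightarrow> \<forall>z\<in>Z. k z = 0"
  shows "\<exists>S\<subseteq>Z \<union> e ` Z. alg_indep_over constants S \<and> card Z < card S"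
proof (rule ccontr)
  assume contra: "\<not> ?thesis"
  define Der where "Der = {\<delta> :: 'a \<Rightarrow> 'a. derivation_on UNIV \<delta> \<and> (\<forall>c\<in>constants. \<delta> c = 0)}"
  define u where "u \<delta> z = \<delta> (e z) / e z - \<delta> z" for \<delta> z
  have "finite (Z \<union> e ` Z)" using fin by simp
  from alg_indep_subset_exists[OF subfield_constants this] obtain S
    where S: "S \<subseteq> Z \<union> e ` Z" "alg_indep_over constants S"
      "\<forall>g\<in>Z \<union> e ` Z. algebraic_over (adjoin constants S) g" by blast
  have finS: "finite S" using S(1) fin finite_subset by blast
  have card: "card S \<le> card Z" using contra S by (meson not_le)
  have Der_comb: "(\<lambda>x. \<Sum>i\<in>I. a i * v i x) \<in> Der" if "\<And>i. i \<in> I \<Longrightarrow> v i \<in> Der"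
    for I :: "'i set" and a v
    using that derivation_linear_combination[of I v a] by (auto simp: Der_def intro!: sum.neutral)
  have der_Der: "der \<in> Der" by (simp add: Der_def derivation_der constants_def)
  obtain z0 where z0: "z0 \<in> Z" using fin by blast
  have "der z0 \<noteq> 0"
  proof
    assume "der z0 = 0"
    then have "z0 \<in> constants" by (simp add: constants_def)
    moreover have "(\<Sum>z\<in>Z. of_int (if z = z0 then 1 else 0) * z) = (\<Sum>z\<in>Z. if z = z0 then z0 else 0)"
      by (intro sum.cong) auto
    ultimately have "(\<Sum>z\<in>Z. of_int (if z = z0 then 1 else 0) * z) \<in> constants"
      using z0 fin by simp
    from ind[OF this] show False using z0 by auto
  qed
  have not_surj: False if surj: "\<forall>g. \<exists>f\<in>u ` Der. \<forall>z\<in>Z. f z = g z"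
  proof -
    have "\<forall>y. \<exists>\<delta>\<in>Der. \<forall>z\<in>Z. u \<delta> z = (if z = y then 1 else 0)"
      using surj by (rule_tac allI) (drule spec, auto)
    then obtain \<delta> where \<delta>: "\<And>y. \<delta> y \<in> Der" "\<And>y z. z \<in> Z \<Longrightarrow> u (\<delta> y) z = (if z = y then 1 else 0)"
      by metis
    define I where "I = insert None (Some ` Z)"
    define v where "v i = (case i of None \<Rightarrow> der | Some z \<Rightarrow> \<delta> z)" for i
    have "card I = Suc (card Z)" using fin by (simp add: I_def card_image)
    then obtain a where a: "\<exists>i\<in>I. a i \<noteq> 0" "\<forall>s\<in>S. (\<Sum>i\<in>I. a i * v i s) = 0"
      using linear_dependence_of_many_vectors[of S I v] finS fin card by (auto simp: I_def)
    define \<eta> where "\<eta> x = (\<Sum>i\<in>I. a i * v i x)" for x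
    have \<eta>: "\<eta> x = a None * der x + (\<Sum>y\<in>Z. a (Some y) * \<delta> y x)" for x
      using fin by (simp add: \<eta>_def I_def v_def sum.reindex)
    have "\<eta> \<in> Der"
      unfolding \<eta>_def using der_Der \<delta>(1) by (intro Der_comb) (auto simp: v_def split: option.splits)
    then have \<eta>0: "\<eta> g = 0" if "g \<in> Z \<union> e ` Z" for g
      using derivation_eq_0_of_transcendence_basis[of \<eta> constants S g] a(2) S(3) that
      by (auto simp: Der_def \<eta>_def)
    \<comment> \<open>Since \<open>u der\<close> is zero on \<open>Z\<close> and the
      \<open>\<delta> y\<close> are dual to the coordinates, \<open>u \<eta> z\<close> reads off
      \<open>a (Some z)\<close>. Only the multiple of \<open>der\<close> survives, and
      \<open>der z0 \<noteq> 0\<close> kills that too.\<close>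
    have a0: "a (Some z) = 0" if z: "z \<in> Z" for z
    proof -
      have "u \<eta> z = a None * u der z + (\<Sum>y\<in>Z. a (Some y) * u (\<delta> y) z)"
        by (simp add: u_def \<eta> right_diff_distrib sum_subtractf add_divide_distrib sum_divide_distrib)
      also have "u der z = 0" using e[OF z] by (simp add: u_def)
      also have "(\<Sum>y\<in>Z. a (Some y) * u (\<delta> y) z) = (\<Sum>y\<in>Z. if y = z then a (Some z) else 0)"
        using z by (intro sum.cong) (auto simp: \<delta>)
      finally show ?thesis using \<eta>0[of z] \<eta>0[of "e z"] z fin by (simp add: u_def)
    qed
    then have "a None * der z0 = 0" using \<eta>0[of z0] z0 by (simp add: \<eta>)
    then show False using a0 a(1) \<open>der z0 \<noteq> 0\<close> by (auto simp: I_def)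
  qed
  have "(\<exists>w. (\<exists>z\<in>Z. w z \<noteq> 0) \<and> (\<forall>f\<in>u ` Der. (\<Sum>z\<in>Z. w z * f z) = 0)) \<or>
      (\<forall>g. \<exists>f\<in>u ` Der. \<forall>z\<in>Z. f z = g z)"
  proof (rule annihilator_or_surjective[OF fin(1)])
    show "(\<lambda>z. f z + g z) \<in> u ` Der" if fg: "f \<in> u ` Der" "g \<in> u ` Der" for f g
    proof -
      obtain \<delta> \<delta>' where "\<delta> \<in> Der" "\<delta>' \<in> Der" "f = u \<delta>" "g = u \<delta>'" using fg by blast
      moreover from this have "(\<lambda>x. \<delta> x + \<delta>' x) \<in> Der"
        by (auto simp: Der_def derivation_on_def algebra_simps)
      moreover have "(\<lambda>z. u \<delta> z + u \<delta>' z) = u (\<lambda>x. \<delta> x + \<delta>' x)"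
        by (auto simp: u_def add_divide_distrib)
      ultimately show ?thesis by blast
    qed
    show "(\<lambda>z. a * f z) \<in> u ` Der" if f: "f \<in> u ` Der" for a f
    proof -
      obtain \<delta> where "\<delta> \<in> Der" "f = u \<delta>" using f by blast
      moreover from this have "(\<lambda>x. a * \<delta> x) \<in> Der"
        by (auto simp: Der_def derivation_on_def algebra_simps)
      moreover have "(\<lambda>z. a * u \<delta> z) = u (\<lambda>x. a * \<delta> x)"
        by (auto simp: u_def right_diff_distrib)
      ultimately show ?thesis by blast
    qed
    show "u ` Der \<noteq> {}" using der_Der by blast
  qed
  then obtain w where w: "\<exists>z\<in>Z. w z \<noteq> 0" "\<forall>\<delta>\<in>Der. (\<Sum>z\<in>Z. w z * u \<delta> z) = 0"
    using not_surj by blast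
  obtain c where c: "\<forall>z\<in>Z. c z \<in> constants" "\<exists>z\<in>Z. c z \<noteq> 0"
    "\<forall>\<delta>\<in>Der. (\<Sum>z\<in>Z. c z * (\<delta> (e z) / e z - \<delta> z)) = 0"
    using constant_relation_exists[OF fin(1) e w(1) w(2)[unfolded u_def Der_def]] unfolding Der_def by blast
  show False
    using no_constant_relation[OF fin(1) e ind c(1,2)] c(3) unfolding Der_def by blast
qed


subsection \<open>Linear equations with constant coefficients\<close>

lemma to_mod_constants_0_iff: "to_mod_constants x = 0 \<longleftrightarrow> x \<in> constants"
  unfolding zero_mod_constants_def by (simp add: mod_constants.abs_eq_iff)

lemma sum_to_mod_constants:
  "(\<Sum>z\<in>Z. scale_mod_constants (of_int (k z)) (to_mod_constants z)) =
    to_mod_constants (\<Sum>z\<in>Z. of_int (k z) * z)"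
  by (induction Z rule: infinite_finite_induct)
    (simp_all add: zero_mod_constants_def plus_mod_constants.abs_eq[symmetric] scale_mod_constants.abs_eq)

text \<open>A basis of the span of the image of \<open>G\<close> modulo constants is chosen inside
  that image and lifted injectively to \<open>G\<close>. The clause on \<open>Z = {}\<close> later
  shows that the basis is nonempty.\<close>

lemma ldim_mod_constants_basis:
  fixes G :: "'a::differential_field set"
  assumes "finite G"
  obtains Z where "Z \<subseteq> G" "card Z = ldim_mod_constants G" "Z = {} \<Longrightarrow> G \<subseteq> constants"
    "\<And>k :: 'a \<Rightarrow> int. (\<Sum>z\<in>Z. of_int (k z) * z) \<in> constants \<Longrightarrow> \<forall>z\<in>Z. k z = 0"
proof -
  let ?t = "to_mod_constants :: 'a \<Rightarrow> 'a mod_constants"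
  obtain B where B: "B \<subseteq> ?t ` G" "mod_constants.independent B" "?t ` G \<subseteq> mod_constants.span B"
    "card B = mod_constants.dim (?t ` G)"
    using mod_constants.basis_exists[of "?t ` G"] by blast
  obtain Z where Z: "Z \<subseteq> G" "inj_on ?t Z" "B = ?t ` Z"
    using B(1) by (meson subset_image_inj)
  have finZ: "finite Z" using Z(1) assms finite_subset by blast
  have "\<forall>z\<in>Z. k z = 0" if k: "(\<Sum>z\<in>Z. of_int (k z) * z) \<in> constants" for k :: "'a \<Rightarrow> int"
  proof
    fix z assume z: "z \<in> Z"
    \<comment> \<open>Coefficients are moved from \<open>Z\<close> to its image by inverting the
      projection, which is injective on \<open>Z\<close>.\<close>
    define f where "f v = (of_int (k (the_inv_into Z ?t v)) :: rat)" for v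
    have f: "f (?t y) = of_int (k y)" if "y \<in> Z" for y
      using that Z(2) by (simp add: f_def the_inv_into_f_f)
    have "(\<Sum>v\<in>B. scale_mod_constants (f v) v) = (\<Sum>y\<in>Z. scale_mod_constants (of_int (k y)) (?t y))"
      unfolding Z(3) by (subst sum.reindex[OF Z(2)]) (simp add: f)
    also have "\<dots> = 0" using k by (simp add: sum_to_mod_constants to_mod_constants_0_iff)
    finally have "f (?t z) = 0"
      using mod_constants.independentD[OF B(2), of B f "?t z"] finZ z Z(3) by blast
    then show "k z = 0" using f[OF z] by simp
  qed
  moreover have "card Z = ldim_mod_constants G"
    using B(4) Z by (simp add: ldim_mod_constants_def mod_constants.dim_span card_image)
  moreover have "G \<subseteq> constants" if "Z = {}"
    using B(3) Z(3) that by (auto simp: to_mod_constants_0_iff)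
  ultimately show ?thesis using that Z(1) by blast
qed

text \<open>Evaluating \<open>(p / (T - \<mu>))(\<partial>\<^sub>x)\<close> at a solution \<open>y\<close> of \<open>p(\<partial>\<^sub>x) y = 0\<close> gives an eigenvector of
  \<open>\<partial>\<^sub>x\<close> for the eigenvalue \<open>\<mu>\<close>, that is, an exponential of \<open>\<mu> x\<close>.\<close>

lemma eigenvector_of_solution:
  fixes x y \<mu> :: "'a::differential_field" and q :: "'a poly"
  assumes x: "der x \<noteq> 0" and q: "q \<in> polys_over constants" and \<mu>: "\<mu> \<in> constants"
    and sol: "(\<Sum>k\<le>Suc (degree q). coeff ([:- \<mu>, 1:] * q) k * (der_wrt x ^^ k) y) = 0"
  defines "v \<equiv> \<Sum>k\<le>degree q. coeff q k * (der_wrt x ^^ k) y"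
  shows "der v = v * der (\<mu> * x)"
proof -
  let ?n = "degree q" and ?Y = "\<lambda>k. (der_wrt x ^^ k) y"
  have const: "der (coeff q k) = 0" for k using polys_over_coeff[OF q] by (auto simp: constants_def)
  have Y: "der (?Y k) = der x * ?Y (Suc k)" for k using x by (simp add: der_wrt_def)
  have "der v = der x * (\<Sum>k\<le>?n. coeff q k * ?Y (Suc k))"
    unfolding v_def
    by (simp only: derivation_sum[OF subfield_UNIV derivation_der] UNIV_I der_mult const Y)
      (simp add: sum_distrib_left mult_ac)
  moreover have "(\<Sum>k\<le>?n. coeff q k * ?Y (Suc k)) = \<mu> * v"
  proof -
    \<comment> \<open>The shifted summand yields the sum of \<open>coeff q k * ?Y (Suc k)\<close>;
      in the other one the index \<open>Suc ?n\<close> contributes nothing because it exceeds the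
      degree of \<open>q\<close>.\<close>
    have "coeff ([:- \<mu>, 1:] * q) k = - \<mu> * coeff q k + (if k = 0 then 0 else coeff q (k - 1))" for k
      by (simp add: coeff_pCons split: nat.split)
    then have "0 = (\<Sum>k\<le>Suc ?n. - \<mu> * (coeff q k * ?Y k)) + (\<Sum>k\<le>Suc ?n. (if k = 0 then 0 else coeff q (k - 1)) * ?Y k)"
      using sol by (simp only: distrib_right sum.distrib mult.assoc)
    also have "(\<Sum>k\<le>Suc ?n. - \<mu> * (coeff q k * ?Y k)) = - \<mu> * v"
      by (simp add: v_def coeff_eq_0 sum_distrib_left sum_negf)
    also have "(\<Sum>k\<le>Suc ?n. (if k = 0 then 0 else coeff q (k - 1)) * ?Y k) = (\<Sum>k\<le>?n. coeff q k * ?Y (Suc k))"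
      by (subst sum.atMost_Suc_shift) simp
    finally show ?thesis by (simp add: algebra_simps)
  qed
  moreover have "der (\<mu> * x) = \<mu> * der x" using \<mu> by (simp add: der_mult constants_def)
  ultimately show ?thesis by simp
qed

theorem theorem3p4:
  fixes c lam x y :: "nat \<Rightarrow> 'a::differential_field" and n m :: nat
  assumes "n \<ge> 1" and "m \<ge> 1"
    and "\<forall>k<n. c k \<in> constants" and "c 0 \<noteq> 0"
    and "\<forall>j\<in>{1..n}. lam j \<in> constants"
    and "monom 1 n + (\<Sum>k<n. monom (c k) k) = (\<Prod>j=1..n. [:- lam j, 1:])"
    and "\<forall>i\<in>{1..m}. x i \<notin> constants"
    and "\<forall>i\<in>{1..m}. Delta n c (x i) (y i) = 0"
    and "\<forall>i\<in>{1..m}. lin_indep_over constants n (\<lambda>k. (der_wrt (x i) ^^ k) (y i))"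
  shows "trdeg constants
           (adjoin constants
             ({x i | i. i \<in> {1..m}} \<union>
              {(der_wrt (x i) ^^ k) (y i) | i k. i \<in> {1..m} \<and> k < n}))
         \<ge> enat (ldim_mod_constants {lam j * x i | i j. i \<in> {1..m} \<and> j \<in> {1..n}}) + 1"
proof -
  let ?S = "{x i | i. i \<in> {1..m}} \<union> {(der_wrt (x i) ^^ k) (y i) | i k. i \<in> {1..m} \<and> k < n}"
  let ?L = "adjoin constants ?S"
  let ?G = "{lam j * x i | i j. i \<in> {1..m} \<and> j \<in> {1..n}}"
  let ?p = "monom 1 n + (\<Sum>k<n. monom (c k) k)"
  note C = subfield_constants[where 'a = 'a]
  note L = subfield_adjoin[of constants ?S]
  have CL: "constants \<subseteq> ?L" by (rule adjoin_base)
  have xL: "x i \<in> ?L" if "i \<in> {1..m}" for i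
    by (rule subsetD[OF adjoin_generators]) (use that in blast)
  have yL: "(der_wrt (x i) ^^ k) (y i) \<in> ?L" if "i \<in> {1..m}" "k < n" for i k
    by (rule subsetD[OF adjoin_generators]) (use that in blast)
  have coeff_p: "coeff ?p k = (if k = n then 1 else if k < n then c k else 0)" for k
    by (simp add: coeff_sum) 
  \<comment> \<open>Up to sign, the product of the roots is \<open>c 0\<close>, so no root is
    zero.\<close>
  have "poly ?p 0 = c 0"
    using coeff_p[of 0] assms(1) by (simp only: poly_0_coeff_0) simp
  then have "(\<Prod>j=1..n. - lam j) = c 0" by (simp add: assms(6) poly_prod)
  then have lam0: "lam j \<noteq> 0" if "j \<in> {1..n}" for j
    using assms(4) that by (metis (no_types, lifting) finite_atLeastAtMost neg_equal_0_iff_equal prod_zero)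
  have exponential: "\<exists>v\<in>?L. v \<noteq> 0 \<and> der v = v * der g" if g: "g \<in> ?G" for g
  proof -
    obtain i j where ij: "i \<in> {1..m}" "j \<in> {1..n}" "g = lam j * x i" using g by blast
    \<comment> \<open>The cofactor of one occurrence of the root \<open>lam j\<close>, of degree
      \<open>n - 1\<close>. Hence \<open>v\<close> involves only derivatives of order below
      \<open>n\<close>, which lie in \<open>?L\<close>.\<close>
    define q where "q = (\<Prod>k\<in>{1..n} - {j}. [:- lam k, 1:])"
    let ?Y = "\<lambda>k. (der_wrt (x i) ^^ k) (y i)"
    have dx: "der (x i) \<noteq> 0" using assms(7) ij by (auto simp: constants_def)
    have pq: "?p = [:- lam j, 1:] * q"
      unfolding assms(6) q_def using ij by (simp add: prod.remove del: mult_pCons_left)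
    have q0: "q \<noteq> 0" by (simp add: q_def)
    have "degree q = (\<Sum>k\<in>{1..n} - {j}. degree [:- lam k, 1:])"
      unfolding q_def by (rule degree_prod_eq_sum_degree) simp
    then have deg: "Suc (degree q) = n" using ij by simp
    have lamC: "lam k \<in> constants" if "k \<in> {1..n} - {j}" for k using that assms(5) by blast
    have "(\<Prod>k\<in>A. [:- lam k, 1:]) \<in> polys_over constants" if "A \<subseteq> {1..n} - {j}" for A
      using that lamC by (induction A rule: infinite_finite_induct)
        (auto intro!: polys_over_closed subfield_closed C)
    then have qC: "q \<in> polys_over constants" unfolding q_def by blast
    define v where "v = (\<Sum>k\<le>degree q. coeff q k * ?Y k)"
    have "(\<Sum>k\<le>n. coeff ?p k * ?Y k) = (\<Sum>k<n. c k * ?Y k) + ?Y n"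
      by (simp only: lessThan_Suc_atMost[symmetric] sum.lessThan_Suc coeff_p) simp
    \<comment> \<open>As \<open>der (x i)\<close> is nonzero, its power in \<open>Delta\<close>
      cancels.\<close>
    also have "\<dots> = 0" using bspec[OF assms(8) ij(1)] dx by (simp add: Delta_def add.commute)
    finally have "der v = v * der g"
      unfolding v_def ij(3)
      by (intro eigenvector_of_solution[OF dx qC]) (use assms(5) ij in \<open>simp_all add: deg pq\<close>)
    moreover have "v \<in> ?L"
      unfolding v_def using deg CL yL[OF ij(1)] polys_over_coeff[OF qC]
      by (intro subfield_sum[OF L] subfield_mult[OF L]) auto
    \<comment> \<open>Linear independence would annihilate every coefficient of \<open>q\<close>,
      including the leading one.\<close>
    moreover have "v \<noteq> 0"
    proof
      assume "v = 0"
      then have "(\<Sum>k<n. coeff q k * ?Y k) = 0"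
        using deg by (simp add: v_def lessThan_Suc_atMost[symmetric])
      then have "\<forall>k<n. coeff q k = 0"
        using assms(9) ij polys_over_coeff[OF qC] unfolding lin_indep_over_def by blast
      then have "lead_coeff q = 0" using deg by simp
      then show False using q0 by simp
    qed
    ultimately show ?thesis by blast
  qed
  have "?G \<subseteq> (\<lambda>(i, j). lam j * x i) ` ({1..m} \<times> {1..n})" by fast
  then have "finite ?G" by (rule finite_subset) simp
  then obtain Z where Z: "Z \<subseteq> ?G" "card Z = ldim_mod_constants ?G"
    and empty: "Z = {} \<Longrightarrow> ?G \<subseteq> constants" and ind: "\<And>k :: 'a \<Rightarrow> int. (\<Sum>z\<in>Z. of_int (k z) * z) \<in> constants \<Longrightarrow> \<forall>z\<in>Z. k z = 0"
    using ldim_mod_constants_basis[of ?G] by blast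
  have finZ: "finite Z" using Z(1) \<open>finite ?G\<close> finite_subset by blast
  have "\<forall>z\<in>Z. \<exists>v. v \<in> ?L \<and> v \<noteq> 0 \<and> der v = v * der z"
  proof
    fix z assume "z \<in> Z"
    then have "z \<in> ?G" using Z(1) by (rule subsetD[rotated])
    from exponential[OF this] show "\<exists>v. v \<in> ?L \<and> v \<noteq> 0 \<and> der v = v * der z" by (simp only: Bex_def)
  qed
  from bchoice[OF this] obtain e where "\<forall>z\<in>Z. e z \<in> ?L \<and> e z \<noteq> 0 \<and> der (e z) = e z * der z" ..
  then have e: "e z \<in> ?L" "e z \<noteq> 0" "der (e z) = e z * der z" if "z \<in> Z" for z
    using that by simp_all
  have GL: "?G \<subseteq> ?L"
  proof
    fix g assume "g \<in> ?G"
    then obtain i j where ij: "i \<in> {1..m}" "j \<in> {1..n}" and g: "g = lam j * x i" by blast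
    have "lam j \<in> ?L" using CL assms(5) ij(2) by (meson subsetD)
    then show "g \<in> ?L" unfolding g by (rule subfield_mult[OF L _ xL[OF ij(1)]])
  qed
  \<comment> \<open>This rules out \<open>Z = {}\<close>, so Ax's theorem applies and supplies the
    summand 1 in the bound.\<close>
  have "lam 1 * x 1 \<notin> constants"
  proof
    assume "lam 1 * x 1 \<in> constants"
    then have "lam 1 * x 1 / lam 1 \<in> constants" using assms(1,5) by (intro subfield_divide[OF C]) auto
    then show False using lam0[of 1] assms(1,2,7) by simp
  qed
  moreover have "lam 1 * x 1 \<in> ?G" using assms(1,2) by auto
  ultimately have "Z \<noteq> {}" using empty by blast
  then obtain S where S: "S \<subseteq> Z \<union> e ` Z" "alg_indep_over constants S" "card Z < card S"
    using ax_schanuel[OF finZ _ e(2,3) ind] by blast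
  have "Z \<union> e ` Z \<subseteq> ?L" using subset_trans[OF Z(1) GL] e(1) by (simp only: Un_subset_iff image_subset_iff) simp
  then have SL: "S \<subseteq> ?L" "finite S" using S(1) finZ finite_subset[of S "Z \<union> e ` Z"] by auto
  have "enat (ldim_mod_constants ?G) + 1 = enat (Suc (card Z))" by (simp add: Z(2) one_enat_def)
  also have "\<dots> \<le> enat (card S)" using S(3) by simp
  also have "\<dots> \<le> trdeg constants ?L" unfolding trdeg_def by (rule SUP_upper) (use S SL in blast)
  finally show ?thesis .
qed

end
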